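(* Let $\{\mathbf{C}(N)\}_{N\ge 0}$ be the Half-Plane Half-Comb (HPHC) random walk on $\mathbb{Z}^2$ started at $\mathbf{C}(0)=(0,0)$. Then $$\mathbf{P}(\mathbf{C}(2N)=(0,0))\sim \frac{2}{\pi N},\qquad N\to\infty,$$ i.e. $\lim_{N\to\infty} \frac{\pi N}{2}\,\mathbf{P}(\mathbf{C}(2N)=(0,0))=1$.
   Context: The HPHC random walk $\mathbf{C}(N)=(C_1(N),C_2(N))$, $N=0,1,2,\ldots$, is the time-homogeneous Markov chain on $\mathbb{Z}^2$ with one-step transition probabilities $$\mathbf{P}(\mathbf{C}(N+1)=(k\pm1,j)\mid \mathbf{C}(N)=(k,j))=\tfrac12-p_j \quad\text{(for each choice of sign)},$$ $$\mathbf{P}(\mathbf{C}(N+1)=(k,j\pm1)\mid \mathbf{C}(N)=(k,j))=p_j \quad\text{(for each choice of sign)},$$ where $p_j=\tfrac14$ for $j\ge 0$ and $p_j=\tfrac12$ for $j<0$. (So the walk is a simple symmetric walk on the square lattice when $j\ge0$, and moves only vertically when $j<0$.) *)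

theory Defs
  imports "HOL-Probability.Probability" "HOL-Library.Landau_Symbols"
begin

text \<open>
  A discrete-time process \<open>X\<close> on \<open>M\<close> is a time-homogeneous Markov chain with one-step transition
  probabilities \<open>p s t\<close> (from \<open>s\<close> to \<open>t\<close>). The Markov property is imposed by conditioning on
  the whole past \<open>X 0 = s 0, \<dots>, X n = s n\<close>, whenever that event has positive probability.
\<close>

definition markov_chain ::
  "'w measure \<Rightarrow> (nat \<Rightarrow> 'w \<Rightarrow> 's) \<Rightarrow> ('s \<Rightarrow> 's \<Rightarrow> real) \<Rightarrow> bool" where
  "markov_chain M X p \<longleftrightarrow>
     prob_space M \<and>
     (\<forall>n. X n \<in> M \<rightarrow>\<^sub>M count_space UNIV) \<and>
     (\<forall>n s t. \<P>(\<omega> in M. \<forall>i\<le>n. X i \<omega> = s i) > 0 \<longrightarrow>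
        \<P>(\<omega> in M. X (Suc n) \<omega> = t \<bar> \<forall>i\<le>n. X i \<omega> = s i) = p (s n) t)"

definition HPHC_p :: "int \<Rightarrow> real" where
  "HPHC_p j = (if j \<ge> 0 then 1/4 else 1/2)"

fun HPHC_step :: "int \<times> int \<Rightarrow> int \<times> int \<Rightarrow> real" where
  "HPHC_step (k, j) (k', j') =
     (if (k', j') = (k + 1, j) \<or> (k', j') = (k - 1, j) then 1/2 - HPHC_p j
      else if (k', j') = (k, j + 1) \<or> (k', j') = (k, j - 1) then HPHC_p j
      else 0)"

definition HPHC_walk :: "'w measure \<Rightarrow> (nat \<Rightarrow> 'w \<Rightarrow> int \<times> int) \<Rightarrow> bool" where
  "HPHC_walk M C \<longleftrightarrow> markov_chain M C HPHC_step \<and> (AE \<omega> in M. C 0 \<omega> = (0, 0))"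

end

theory Submission
  imports Defs "HOL-Real_Asymp.Real_Asymp"
begin

text \<open>
  A Fourier transform in the horizontal coordinate turns the walk into a one-parameter family of
  operators on the vertical line, which are self-adjoint with respect to the reversible measure
  (weight \<open>1\<close> above, \<open>1/2\<close> below). Self-adjointness and contractivity show that the return
  probabilities at even times decrease. The Green function of each fibre operator at the origin is
  explicit, so that \<open>\<Sum>n. n p\<^sub>n z\<^sup>n\<close> is an explicit integral over the frequency \<open>\<theta>\<close>; the substitution
  \<open>\<theta> = t \<surd>(1 - z)\<close> shows that it is asymptotic to \<open>2 / (\<pi> (1 - z))\<close> as \<open>z \<rightarrow> 1\<close>. For a logarithmic
  singularity the Karamata theorem for partial sums loses the constant, which is why the generating
  function is differentiated first; combined with monotonicity, Karamata's theorem for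
  \<open>n p\<^sub>n\<close> then yields the pointwise asymptotics.
\<close>

section \<open>A Tauberian theorem for decreasing sequences\<close>

text \<open>If p(2n) behaves like c/n, its partial sums grow like c log n, and a block from n to (1
  + d) n adds only a bounded amount, invisible next to log n. With the extra factor n, such a block
  carries a fixed share of the total, which is what a pointwise conclusion needs. Write s = sqrt (1
  - z). For \<theta> of order s the z-derivative of the fibre Green function has order s^(-3), and
  this range has width of order s, whence s^(-2) = 1 / (1 - z). At a fixed \<theta> > 0 the
  derivative has only order 1/s, coming from the lower half-plane term
  \<open>z / sqrt (1 - z\<^sup>2)\<close>. The constant: the limiting integral over t equals 2, and
  the Fourier normalisation divides it by pi. Passing to even times with z = sqrt w, the index
  change 2n to n halves the series while 1 - z ~ (1 - w) / 2 doubles it, so 2 / pi survives.\<close>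

lemma karamata_power:
  fixes b :: "nat \<Rightarrow> real"
  assumes lim: "((\<lambda>w. (1 - w) * (\<Sum>n. b n * w ^ n)) \<longlongrightarrow> c) (at_left 1)"
  shows "((\<lambda>w. (1 - w) * (\<Sum>n. b n * w ^ n * (w ^ n) ^ k)) \<longlongrightarrow> c / (Suc k)) (at_left 1)"
proof -
  have "((\<lambda>w::real. w ^ Suc k) \<longlongrightarrow> 1) (at_left 1)"
    by (auto intro!: tendsto_eq_intros)
  moreover have near: "eventually (\<lambda>w::real. w \<in> {0<..<1}) (at_left 1)"
    by (rule eventually_at_leftI[of 0]) auto
  ultimately have "filterlim (\<lambda>w::real. w ^ Suc k) (at_left 1) (at_left 1)"
    unfolding filterlim_at
    by (auto elim!: eventually_mono simp: power_Suc_less_one less_imp_neq simp del: power_Suc)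
  \<comment> \<open>The hypothesis is read at \<open>w ^ Suc k\<close>. Since 1 - w^(k+1) is (1 - w)
    times a geometric sum tending to k + 1, the limit becomes c / (k + 1), that is, c times the
    integral of x^k over [0, 1].\<close>
  from filterlim_compose[OF lim this]
  have A: "((\<lambda>w. (1 - w ^ Suc k) * (\<Sum>n. b n * (w ^ Suc k) ^ n)) \<longlongrightarrow> c) (at_left 1)" .
  have "((\<lambda>w. \<Sum>i<Suc k. w ^ i) \<longlongrightarrow> (\<Sum>i<Suc k. 1 ^ i)) (at_left (1::real))"
    by (intro tendsto_intros)
  hence "((\<lambda>w. ((1 - w ^ Suc k) * (\<Sum>n. b n * (w ^ Suc k) ^ n)) / (\<Sum>i<Suc k. w ^ i)) \<longlongrightarrow> c / Suc k) (at_left 1)"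
    by (intro tendsto_divide[OF A]) auto
  moreover have "eventually (\<lambda>w. ((1 - w ^ Suc k) * (\<Sum>n. b n * (w ^ Suc k) ^ n)) / (\<Sum>i<Suc k. w ^ i)
      = (1 - w) * (\<Sum>n. b n * w ^ n * (w ^ n) ^ k)) (at_left 1)"
    using near
  proof eventually_elim
    case (elim w)
    have "(\<Sum>i<Suc k. w ^ i) > 0" using elim by (intro sum_pos) auto
    moreover have "1 - w ^ Suc k = (1 - w) * (\<Sum>i<Suc k. w ^ i)"
      using one_diff_power_eq[of w "Suc k"] .
    moreover have "(\<lambda>n. b n * (w ^ Suc k) ^ n) = (\<lambda>n. b n * w ^ n * (w ^ n) ^ k)"
      by (simp add: power_mult_distrib mult.assoc flip: power_mult) (simp add: mult.commute)
    ultimately show ?case using elim by simp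
  qed
  ultimately show ?thesis by (rule Lim_transform_eventually)
qed

text \<open>Both sides are linear in \<open>\<phi>\<close>, so monomials give polynomials.
  Stone-Weierstrass then suffices, because a uniform error d in \<open>\<phi>\<close> costs at most
  d times the convergent expression of \<open>lim\<close>.\<close>

lemma karamata_continuous:
  fixes b :: "nat \<Rightarrow> real" and \<phi> :: "real \<Rightarrow> real"
  assumes nonneg: "\<And>n. 0 \<le> b n"
    and summable: "\<And>w. w \<in> {0<..<1} \<Longrightarrow> summable (\<lambda>n. b n * w ^ n)"
    and lim: "((\<lambda>w. (1 - w) * (\<Sum>n. b n * w ^ n)) \<longlongrightarrow> c) (at_left 1)"
    and cont: "continuous_on {0..1} \<phi>"
  shows "((\<lambda>w. (1 - w) * (\<Sum>n. b n * w ^ n * \<phi> (w ^ n))) \<longlongrightarrow> c * integral {0..1} \<phi>) (at_left 1)"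
proof -
  let ?L = "\<lambda>f w. (1 - w) * (\<Sum>n. b n * w ^ n * f (w ^ n))"
  have near: "eventually (\<lambda>w::real. w \<in> {0<..<1}) (at_left 1)"
    by (rule eventually_at_leftI[of 0]) auto
  have unit: "w ^ n \<in> {0..1}" if "w \<in> {0<..<1}" for w :: real and n
    using that by (auto simp: power_le_one)
  have sm: "summable (\<lambda>n. b n * w ^ n * f (w ^ n))"
    if w: "w \<in> {0<..<1}" and f: "continuous_on {0..1} f" for w f
  proof -
    have "compact (f ` {0..1})" using f by (intro compact_continuous_image) auto
    then obtain B where B: "\<And>x. x \<in> {0..1} \<Longrightarrow> \<bar>f x\<bar> \<le> B"
      unfolding real_norm_def[symmetric] by (metis bounded_iff compact_imp_bounded imageI)
    show ?thesis
    proof (rule summable_comparison_test')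
      show "summable (\<lambda>n. B * (b n * w ^ n))" using summable[OF w] by (rule summable_mult)
      show "norm (b n * w ^ n * f (w ^ n)) \<le> B * (b n * w ^ n)" for n
        using mult_left_mono[OF B[OF unit[OF w]], of "b n * w ^ n" n] nonneg[of n] w
        by (auto simp: abs_mult mult_ac)
    qed
  qed
  have c0: "c \<ge> 0"
    by (rule tendsto_lowerbound[OF lim])
       (use near nonneg summable in \<open>auto elim!: eventually_mono intro!: mult_nonneg_nonneg suminf_nonneg\<close>)
  have poly: "(?L (\<lambda>x. \<Sum>i\<le>m. a i * x ^ i) \<longlongrightarrow> c * integral {0..1} (\<lambda>x. \<Sum>i\<le>m. a i * x ^ i)) (at_left 1)"
    for a :: "nat \<Rightarrow> real" and m
  proof -
    have "((\<lambda>w. \<Sum>i\<le>m. a i * ?L (\<lambda>x. x ^ i) w) \<longlongrightarrow> (\<Sum>i\<le>m. a i * (c / Suc i))) (at_left 1)"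
      by (intro tendsto_intros karamata_power lim)
    moreover have "eventually (\<lambda>w. (\<Sum>i\<le>m. a i * ?L (\<lambda>x. x ^ i) w) = ?L (\<lambda>x. \<Sum>i\<le>m. a i * x ^ i) w) (at_left 1)"
      using near
    proof eventually_elim
      case (elim w)
      have s: "summable (\<lambda>n. b n * w ^ n * (w ^ n) ^ i)" for i
        by (rule sm[OF elim]) (intro continuous_intros)
      have "(\<Sum>n. b n * w ^ n * (\<Sum>i\<le>m. a i * (w ^ n) ^ i)) = (\<Sum>n. \<Sum>i\<le>m. a i * (b n * w ^ n * (w ^ n) ^ i))"
        by (simp add: sum_distrib_left mult_ac)
      also have "\<dots> = (\<Sum>i\<le>m. \<Sum>n. a i * (b n * w ^ n * (w ^ n) ^ i))"
        by (intro suminf_sum summable_mult s)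
      also have "\<dots> = (\<Sum>i\<le>m. a i * (\<Sum>n. b n * w ^ n * (w ^ n) ^ i))"
        by (intro sum.cong refl suminf_mult s)
      finally show ?case by (simp add: sum_distrib_left mult_ac)
    qed
    moreover have "integral {0..1} (\<lambda>x. \<Sum>i\<le>m. a i * x ^ i) = (\<Sum>i\<le>m. a i / Suc i)"
    proof (rule integral_unique)
      have "((\<lambda>x. x ^ i) has_integral (1 ^ Suc i / Suc i - 0 ^ Suc i / Suc i)) {0..1::real}" for i
      proof (rule fundamental_theorem_of_calculus)
        fix x :: real
        show "((\<lambda>x. x ^ Suc i / Suc i) has_vector_derivative x ^ i) (at x within {0..1})"
          using DERIV_cdivide[OF DERIV_pow[of "Suc i" x "{0..1}"], of "Suc i"]
          by (simp del: of_nat_Suc power_Suc flip: has_real_derivative_iff_has_vector_derivative)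
      qed simp
      hence "((\<lambda>x. \<Sum>i\<le>m. a i * x ^ i) has_integral (\<Sum>i\<le>m. a i * (1 / Suc i))) {0..1::real}"
        by (intro has_integral_sum has_integral_mult_right) auto
      thus "((\<lambda>x. \<Sum>i\<le>m. a i * x ^ i) has_integral (\<Sum>i\<le>m. a i / Suc i)) {0..1::real}" by simp
    qed
    moreover have "c * (\<Sum>i\<le>m. a i / Suc i) = (\<Sum>i\<le>m. a i * (c / Suc i))"
      unfolding sum_distrib_left by (intro sum.cong refl) (simp add: ac_simps)
    ultimately show ?thesis by (simp only: Lim_transform_eventually)
  qed
  show ?thesis
  proof (rule tendstoI)
    fix e :: real assume e: "e > 0"
    \<comment> \<open>The approximation error enters twice, in the series and in the integral, and
      has limit 2 c d = e - 2 d. The added 2 keeps the denominator positive when c = 0.\<close>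
    define d where "d = e / (2 * c + 2)"
    have d: "d > 0" using e c0 by (simp add: d_def)
    obtain g where g: "real_polynomial_function g" "\<And>x. x \<in> {0..1} \<Longrightarrow> \<bar>\<phi> x - g x\<bar> < d"
      using Stone_Weierstrass_real_polynomial_function[OF compact_Icc cont d] by auto
    from real_polynomial_function_imp_sum[OF g(1)] obtain a m
      where gs: "g = (\<lambda>x. \<Sum>i\<le>(m::nat). a i * x ^ i)" by blast
    have gc: "continuous_on {0..1} g" unfolding gs by (intro continuous_intros)
    have int: "\<bar>integral {0..1} \<phi> - integral {0..1} g\<bar> \<le> d"
    proof -
      have "integral {0..1} \<phi> - integral {0..1} g = integral {0..1} (\<lambda>x. \<phi> x - g x)"
        by (intro integral_diff[symmetric] integrable_continuous_real cont gc)
      also have "norm \<dots> \<le> d * (1 - 0)"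
        using g(2) by (intro integral_bound continuous_intros cont gc) (auto intro: less_imp_le)
      finally show ?thesis by simp
    qed
    have h1: "(?L (\<lambda>_. 1) \<longlongrightarrow> c) (at_left 1)" using lim by simp
    have h2: "(?L g \<longlongrightarrow> c * integral {0..1} g) (at_left 1)" unfolding gs by (rule poly)
    have "((\<lambda>w. d * ?L (\<lambda>_. 1) w + dist (?L g w) (c * integral {0..1} g) + c * d)
        \<longlongrightarrow> d * c + dist (c * integral {0..1} g) (c * integral {0..1} g) + c * d) (at_left 1)"
      by (rule tendsto_add[OF tendsto_add[OF tendsto_mult[OF tendsto_const h1]
            tendsto_dist[OF h2 tendsto_const]] tendsto_const])
    moreover have "d * c + dist (c * integral {0..1} g) (c * integral {0..1} g) + c * d < e"
    proof -
      have "d * (2 * c + 2) = e" using c0 by (simp add: d_def)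
      hence "d * c + c * d = e - 2 * d" by (simp add: algebra_simps)
      thus ?thesis using d by simp
    qed
    ultimately have "eventually (\<lambda>w. d * ?L (\<lambda>_. 1) w + dist (?L g w) (c * integral {0..1} g) + c * d < e) (at_left 1)"
      by (rule order_tendstoD)
    with near show "eventually (\<lambda>w. dist (?L \<phi> w) (c * integral {0..1} \<phi>) < e) (at_left 1)"
    proof eventually_elim
      case (elim w)
      have "\<bar>(\<Sum>n. b n * w ^ n * \<phi> (w ^ n)) - (\<Sum>n. b n * w ^ n * g (w ^ n))\<bar> =
            \<bar>\<Sum>n. b n * w ^ n * (\<phi> (w ^ n) - g (w ^ n))\<bar>"
        by (subst suminf_diff[OF sm[OF elim(1) cont] sm[OF elim(1) gc]]) (simp add: algebra_simps)
      also have "\<dots> \<le> (\<Sum>n. d * (b n * w ^ n))"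
      proof -
        have le: "\<bar>b n * w ^ n * (\<phi> (w ^ n) - g (w ^ n))\<bar> \<le> d * (b n * w ^ n)" for n
          using mult_left_mono[OF less_imp_le[OF g(2)[OF unit[OF elim(1)]]], of "b n * w ^ n" n] nonneg[of n] elim(1)
          by (auto simp: abs_mult mult_ac)
        have s: "summable (\<lambda>n. d * (b n * w ^ n))" by (intro summable_mult summable elim)
        hence "summable (\<lambda>n. \<bar>b n * w ^ n * (\<phi> (w ^ n) - g (w ^ n))\<bar>)"
          by (rule summable_comparison_test'[where N = 0]) (use le in simp)
        thus ?thesis using suminf_le[OF le _ s] by (intro order.trans[OF summable_rabs]) auto
      qed
      also have "\<dots> = d * (\<Sum>n. b n * w ^ n)"
        by (intro suminf_mult summable elim)
      finally have "(1 - w) * \<bar>(\<Sum>n. b n * w ^ n * \<phi> (w ^ n)) - (\<Sum>n. b n * w ^ n * g (w ^ n))\<bar> \<le> (1 - w) * (d * (\<Sum>n. b n * w ^ n))"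
        using elim by (intro mult_left_mono) auto
      also have "(1 - w) * \<bar>(\<Sum>n. b n * w ^ n * \<phi> (w ^ n)) - (\<Sum>n. b n * w ^ n * g (w ^ n))\<bar> = \<bar>?L \<phi> w - ?L g w\<bar>"
        using elim by (simp add: abs_mult flip: right_diff_distrib)
      finally have "\<bar>?L \<phi> w - ?L g w\<bar> \<le> d * ?L (\<lambda>_. 1) w" by (simp add: mult_ac)
      moreover have "\<bar>c * integral {0..1} g - c * integral {0..1} \<phi>\<bar> \<le> c * d"
        using mult_left_mono[OF int c0] c0 by (simp add: abs_mult abs_minus_commute flip: right_diff_distrib)
      ultimately show ?case using elim(2) by (simp add: dist_real_def)
    qed
  qed
qed

lemma exp_div_left_1: "filterlim (\<lambda>n. exp (- 1 / real n)) (at_left 1) sequentially"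
  unfolding filterlim_at
proof
  have "(\<lambda>n. - 1 / real n) \<longlonglongrightarrow> 0" by real_asymp
  from tendsto_exp[OF this] show "(\<lambda>n. exp (- 1 / real n)) \<longlonglongrightarrow> 1" by simp
  show "eventually (\<lambda>n. exp (- 1 / real n) \<in> {..<1} \<and> exp (- 1 / real n) \<noteq> 1) sequentially"
    using eventually_gt_at_top[of 0] by eventually_elim auto
qed

text \<open>
  The weights are \<open>u n k = w\<^sup>k \<phi>(w\<^sup>k)\<close> with \<open>w = exp (-1/n)\<close> and a continuous bump \<open>\<phi>\<close> supported
  on \<open>[exp (-\<beta>), exp (-\<alpha>)]\<close>; a continuous test function suffices because the sequence of
  interest is monotone.
\<close>

lemma karamata_window:
  fixes b :: "nat \<Rightarrow> real" and \<alpha> \<beta> :: real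
  assumes nonneg: "\<And>n. 0 \<le> b n"
    and summable: "\<And>w. w \<in> {0<..<1} \<Longrightarrow> summable (\<lambda>n. b n * w ^ n)"
    and lim: "((\<lambda>w. (1 - w) * (\<Sum>n. b n * w ^ n)) \<longlongrightarrow> c) (at_left 1)"
    and ab: "0 \<le> \<alpha>" "\<alpha> < \<beta>"
  obtains u :: "nat \<Rightarrow> nat \<Rightarrow> real" where
    "\<And>n k. 0 \<le> u n k" "\<And>n k. n > 0 \<Longrightarrow> u n k \<noteq> 0 \<Longrightarrow> \<alpha> * n < k \<and> k < \<beta> * n"
    "\<And>n. n > 0 \<Longrightarrow> summable (u n)" "\<And>n. n > 0 \<Longrightarrow> summable (\<lambda>k. b k * u n k)"
    "eventually (\<lambda>n. (\<Sum>k. u n k) > 0) sequentially"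
    "(\<lambda>n. (\<Sum>k. b k * u n k) / (\<Sum>k. u n k)) \<longlonglongrightarrow> c"
proof -
  define \<phi> where "\<phi> x = max 0 ((x - exp (-\<beta>)) * (exp (-\<alpha>) - x))" for x :: real
  have cont: "continuous_on A \<phi>" for A unfolding \<phi>_def by (intro continuous_intros)
  have \<phi>0: "\<phi> x \<ge> 0" for x by (simp add: \<phi>_def)
  have supp: "exp (-\<beta>) < x \<and> x < exp (-\<alpha>)" if "\<phi> x \<noteq> 0" for x
  proof -
    have "(x - exp (-\<beta>)) * (exp (-\<alpha>) - x) > 0" using that unfolding \<phi>_def max_def by argo
    moreover have "exp (-\<beta>) < exp (-\<alpha>)" using ab by simp
    ultimately show ?thesis unfolding zero_less_mult_iff by linarith
  qed
  define I where "I = integral {0..1} \<phi>"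
  have "I > 0"
  proof -
    let ?x = "(exp (-\<alpha>) + exp (-\<beta>)) / 2"
    have lt: "exp (-\<beta>) < exp (-\<alpha>)" "exp (-\<alpha>) \<le> 1" using ab by auto
    have x: "?x \<in> {0..1}" using lt exp_gt_zero[of "-\<beta>"] exp_gt_zero[of "-\<alpha>"] unfolding atLeastAtMost_iff by argo
    have "\<phi> ?x > 0" using mult_pos_pos[of "?x - exp (-\<beta>)" "exp (-\<alpha>) - ?x"] lt
      unfolding \<phi>_def less_max_iff_disj by argo
    have "I \<noteq> 0"
    proof
      assume "I = 0"
      hence "(\<phi> has_integral 0) {0..1}"
        using integrable_integral[OF integrable_continuous_real[OF cont[of "{0..1}"]]] by (simp add: I_def)
      hence "\<phi> ?x = 0" using x
        using has_integral_0_cbox_imp_0[of 0 1 \<phi> ?x] cont \<phi>0 by simp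
      thus False using \<open>\<phi> ?x > 0\<close> by simp
    qed
    moreover have "I \<ge> 0" unfolding I_def using \<phi>0 by (intro integral_nonneg integrable_continuous_real cont) auto
    ultimately show ?thesis by simp
  qed
  define w where "w n = exp (- 1 / real n)" for n :: nat
  define u where "u n k = w n ^ k * \<phi> (w n ^ k)" for n k
  have w: "w n \<in> {0<..<1}" if "n > 0" for n using that by (auto simp: w_def)
  have wlim: "filterlim w (at_left 1) sequentially" unfolding w_def by (rule exp_div_left_1)
  have wk: "w n ^ k = exp (- (k / n))" for n k
    by (simp add: w_def flip: exp_of_nat_mult)
  have \<phi>1: "\<phi> x \<le> 1" if "x \<in> {0..1}" for x
  proof -
    have *: "(x - exp (-\<beta>)) * (exp (-\<alpha>) - x) \<le> 1" if "0 < x - exp (-\<beta>)"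
    proof -
      have "exp (-\<alpha>) \<le> 1" using ab by simp
      hence "exp (-\<alpha>) - x \<le> 1" using \<open>x \<in> _\<close> unfolding atLeastAtMost_iff by linarith
      hence "(x - exp (-\<beta>)) * (exp (-\<alpha>) - x) \<le> (x - exp (-\<beta>)) * 1"
        using that by (intro mult_left_mono) auto
      also have "\<dots> \<le> 1" using \<open>x \<in> _\<close> exp_gt_zero[of "-\<beta>"] unfolding atLeastAtMost_iff by argo
      finally show ?thesis .
    qed
    show ?thesis
    proof (cases "\<phi> x = 0")
      case False
      hence "0 < x - exp (-\<beta>)" using supp by simp
      from *[OF this] show ?thesis by (simp add: \<phi>_def)
    qed simp
  qed
  \<comment> \<open>The constant sequence 1 satisfies the same hypothesis with limit 1; applied to
    it, the previous lemma evaluates the total weight, and in the quotient of the two limits the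
    unknown integral \<open>I\<close> cancels.\<close>
  have one: "((\<lambda>w::real. (1 - w) * (\<Sum>n. 1 * w ^ n)) \<longlongrightarrow> 1) (at_left 1)"
  proof (rule Lim_transform_eventually[OF tendsto_const])
    show "eventually (\<lambda>w::real. 1 = (1 - w) * (\<Sum>n. 1 * w ^ n)) (at_left 1)"
      by (rule eventually_at_leftI[of 0]) (auto simp: suminf_geometric)
  qed
  have lim_u: "(\<lambda>n. (1 - w n) * (\<Sum>k. u n k)) \<longlonglongrightarrow> I"
    using filterlim_compose[OF karamata_continuous[OF _ _ one cont] wlim]
    by (simp add: u_def I_def)
  have lim_b: "(\<lambda>n. (1 - w n) * (\<Sum>k. b k * u n k)) \<longlonglongrightarrow> c * I"
    using filterlim_compose[OF karamata_continuous[OF nonneg summable lim cont] wlim]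
    by (simp add: u_def I_def mult.assoc)
  have u_le: "0 \<le> u n k" "n > 0 \<Longrightarrow> u n k \<le> w n ^ k" for n k
  proof -
    show "0 \<le> u n k" using \<phi>0 by (simp add: u_def wk)
    assume n: "n > 0"
    have "w n ^ k \<in> {0..1}" using w[OF n] by (auto intro: power_le_one)
    from mult_left_mono[OF \<phi>1[OF this], of "w n ^ k"] this show "u n k \<le> w n ^ k"
      by (simp add: u_def)
  qed
  show thesis
  proof (rule that[of u])
    show "0 \<le> u n k" for n k by (rule u_le)
    show "\<alpha> * n < k \<and> k < \<beta> * n" if "n > 0" "u n k \<noteq> 0" for n k
    proof -
      have "\<phi> (w n ^ k) \<noteq> 0" using that by (auto simp: u_def)
      from supp[OF this] show ?thesis using that(1) by (simp add: wk field_simps)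
    qed
    show "summable (u n)" if "n > 0" for n
      using w[OF that] u_le that
      by (intro summable_comparison_test'[OF summable_geometric[of "w n"]]) auto
    show "summable (\<lambda>k. b k * u n k)" if "n > 0" for n
      using u_le nonneg that
      by (intro summable_comparison_test'[OF summable[OF w[OF that]]]) (auto intro: mult_left_mono)
    show "eventually (\<lambda>n. (\<Sum>k. u n k) > 0) sequentially"
      using order_tendstoD(1)[OF lim_u \<open>I > 0\<close>] eventually_gt_at_top[of 0]
    proof eventually_elim
      case (elim n)
      thus ?case using w[of n] by (auto simp: zero_less_mult_iff)
    qed
    have "(\<lambda>n. ((1 - w n) * (\<Sum>k. b k * u n k)) / ((1 - w n) * (\<Sum>k. u n k))) \<longlonglongrightarrow> c * I / I"
      using \<open>I > 0\<close> by (intro tendsto_divide lim_u lim_b) auto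
    moreover have "eventually (\<lambda>n. ((1 - w n) * (\<Sum>k. b k * u n k)) / ((1 - w n) * (\<Sum>k. u n k)) =
       (\<Sum>k. b k * u n k) / (\<Sum>k. u n k)) sequentially"
      using eventually_gt_at_top[of 0]
    proof eventually_elim
      case (elim n)
      from w[OF elim] have "1 - w n \<noteq> 0" by auto
      thus ?case by (rule mult_divide_mult_cancel_left)
    qed
    ultimately have "(\<lambda>n. (\<Sum>k. b k * u n k) / (\<Sum>k. u n k)) \<longlonglongrightarrow> c * I / I"
      by (rule Lim_transform_eventually)
    thus "(\<lambda>n. (\<Sum>k. b k * u n k) / (\<Sum>k. u n k)) \<longlonglongrightarrow> c"
      using \<open>I > 0\<close> by simp
  qed
qed

text \<open>Only \<open>a\<close> is monotone, not n a(n). On the window from n to (1 + d) n one has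
  k a(k) <= (1 + d) n a(n), and on the window from (1 - d) n to n one has k a(k) >= (1 - d) n a(n).
  Both window averages tend to c, and d is arbitrarily small.\<close>

lemma karamata_decseq:
  fixes a :: "nat \<Rightarrow> real"
  assumes dec: "decseq a" and nonneg: "\<And>n. 0 \<le> a n"
    and summable: "\<And>w. w \<in> {0<..<1} \<Longrightarrow> summable (\<lambda>n. real n * a n * w ^ n)"
    and lim: "((\<lambda>w. (1 - w) * (\<Sum>n. real n * a n * w ^ n)) \<longlongrightarrow> c) (at_left 1)"
  shows "(\<lambda>n. real n * a n) \<longlonglongrightarrow> c"
proof -
  let ?b = "\<lambda>n. real n * a n"
  have b0: "0 \<le> ?b n" for n using nonneg by simp
  have lower: "eventually (\<lambda>n. l < ?b n) sequentially" if l: "l < c" for l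
  proof -
    have "((\<lambda>x. c / (1 + x)) \<longlongrightarrow> c / (1 + 0)) (at_right 0)" by (intro tendsto_intros) auto
    hence "eventually (\<lambda>x. c / (1 + x) > l) (at_right 0)" using l by (intro order_tendstoD) auto
    hence "eventually (\<lambda>x. c / (1 + x) > l \<and> 0 < x) (at_right 0)"
      using eventually_at_right_less by (rule eventually_conj)
    from eventually_happens[OF this] obtain d where d: "d > 0" "c / (1 + d) > l"
      by auto
    hence ab: "0 \<le> (1::real)" "1 < 1 + d" by simp_all
    obtain u :: "nat \<Rightarrow> nat \<Rightarrow> real" where u:
      "\<And>n k. 0 \<le> u n k" "\<And>n k. n > 0 \<Longrightarrow> u n k \<noteq> 0 \<Longrightarrow> 1 * real n < k \<and> k < (1 + d) * n"
      "\<And>n. n > 0 \<Longrightarrow> summable (u n)" "\<And>n. n > 0 \<Longrightarrow> summable (\<lambda>k. ?b k * u n k)"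
      "eventually (\<lambda>n. (\<Sum>k. u n k) > 0) sequentially"
      "(\<lambda>n. (\<Sum>k. ?b k * u n k) / (\<Sum>k. u n k)) \<longlonglongrightarrow> c"
      by (rule karamata_window[OF b0 summable lim ab]) (assumption, rule that)
    have "(\<lambda>n. (\<Sum>k. ?b k * u n k) / (\<Sum>k. u n k) / (1 + d)) \<longlonglongrightarrow> c / (1 + d)"
      using d by (intro tendsto_intros u) auto
    from order_tendstoD(1)[OF this d(2)] u(5) eventually_gt_at_top[of 0] show ?thesis
    proof eventually_elim
      case (elim n)
      have "(\<Sum>k. ?b k * u n k) \<le> (\<Sum>k. (1 + d) * ?b n * u n k)"
      proof (intro suminf_le summable_mult u elim)
        fix k
        show "?b k * u n k \<le> (1 + d) * ?b n * u n k"
        proof (cases "u n k = 0")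
          case False
          from u(2)[OF elim(3) this] have k: "n \<le> k" "real k \<le> (1 + d) * n" by auto
          have "?b k \<le> (1 + d) * n * a n"
            using k d nonneg decseqD[OF dec k(1)] by (intro mult_mono) auto
          thus ?thesis using u(1)[of n k] by (intro mult_right_mono) (auto simp: mult_ac)
        qed simp
      qed
      also have "\<dots> = (1 + d) * ?b n * (\<Sum>k. u n k)" by (intro suminf_mult u elim)
      finally have "(\<Sum>k. ?b k * u n k) / (\<Sum>k. u n k) / (1 + d) \<le> ?b n"
        using elim(2) d by (simp add: pos_divide_le_eq mult_ac)
      thus ?case using elim(1) by linarith
    qed
  qed
  have upper: "eventually (\<lambda>n. ?b n < l) sequentially" if l: "c < l" for l
  proof -
    have "((\<lambda>x. c / (1 - x)) \<longlongrightarrow> c / (1 - 0)) (at_right 0)" by (intro tendsto_intros) auto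
    hence "eventually (\<lambda>x. c / (1 - x) < l) (at_right 0)" using l by (intro order_tendstoD) auto
    moreover have "eventually (\<lambda>x::real. x \<in> {0<..<1}) (at_right 0)"
      by (rule eventually_at_rightI[of 0 1]) auto
    ultimately have "eventually (\<lambda>x. c / (1 - x) < l \<and> x \<in> {0<..<1}) (at_right 0)"
      by (rule eventually_conj)
    from eventually_happens[OF this] obtain d where d: "d > 0" "d < 1" "c / (1 - d) < l"
      by auto
    hence ab: "0 \<le> 1 - d" "1 - d < 1" by simp_all
    obtain u :: "nat \<Rightarrow> nat \<Rightarrow> real" where u:
      "\<And>n k. 0 \<le> u n k" "\<And>n k. n > 0 \<Longrightarrow> u n k \<noteq> 0 \<Longrightarrow> (1 - d) * n < k \<and> k < 1 * real n"
      "\<And>n. n > 0 \<Longrightarrow> summable (u n)" "\<And>n. n > 0 \<Longrightarrow> summable (\<lambda>k. ?b k * u n k)"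
      "eventually (\<lambda>n. (\<Sum>k. u n k) > 0) sequentially"
      "(\<lambda>n. (\<Sum>k. ?b k * u n k) / (\<Sum>k. u n k)) \<longlonglongrightarrow> c"
      by (rule karamata_window[OF b0 summable lim ab]) (assumption, rule that)
    have "(\<lambda>n. (\<Sum>k. ?b k * u n k) / (\<Sum>k. u n k) / (1 - d)) \<longlonglongrightarrow> c / (1 - d)"
      using d by (intro tendsto_intros u) auto
    from order_tendstoD(2)[OF this d(3)] u(5) eventually_gt_at_top[of 0] show ?thesis
    proof eventually_elim
      case (elim n)
      have "(\<Sum>k. (1 - d) * ?b n * u n k) \<le> (\<Sum>k. ?b k * u n k)"
      proof (intro suminf_le summable_mult u elim)
        fix k
        show "(1 - d) * ?b n * u n k \<le> ?b k * u n k"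
        proof (cases "u n k = 0")
          case False
          from u(2)[OF elim(3) this] have k: "k \<le> n" "(1 - d) * n \<le> real k" by auto
          have "(1 - d) * n * a n \<le> ?b k"
            using k d nonneg decseqD[OF dec k(1)] by (intro mult_mono) auto
          thus ?thesis using u(1)[of n k] by (intro mult_right_mono) (auto simp: mult_ac)
        qed simp
      qed
      moreover have "(\<Sum>k. (1 - d) * ?b n * u n k) = (1 - d) * ?b n * (\<Sum>k. u n k)"
        by (intro suminf_mult u elim)
      ultimately have "?b n \<le> (\<Sum>k. ?b k * u n k) / (\<Sum>k. u n k) / (1 - d)"
        using elim(2) d by (simp add: pos_le_divide_eq mult_ac)
      thus ?case using elim(1) by linarith
    qed
  qed
  show ?thesis by (rule order_tendstoI) (use lower upper in auto)
qed

section \<open>Transition equations\<close>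

text \<open>The definition conditions on an entire history. Summing over all histories that end in
  \<open>s\<close> leaves conditioning on the present state alone.\<close>

lemma markov_chain_joint:
  fixes X :: "nat \<Rightarrow> 'w \<Rightarrow> 's :: countable"
  assumes mc: "markov_chain M X p" and p: "\<And>s t. 0 \<le> p s t"
  shows "emeasure M {\<omega> \<in> space M. X (Suc n) \<omega> = t \<and> X n \<omega> = s} =
         ennreal (p s t) * emeasure M {\<omega> \<in> space M. X n \<omega> = s}"
proof -
  interpret prob_space M using mc by (simp add: markov_chain_def)
  have [measurable]: "X m \<in> M \<rightarrow>\<^sub>M count_space UNIV" for m
    using mc by (simp add: markov_chain_def)
  \<comment> \<open>Lists over a countable type form a countable type, so the decomposition by
    history is a countable union; functions on all of nat would not do.\<close>
  define past where "past \<omega> = map (\<lambda>i. X i \<omega>) [0..<n]" for \<omega>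
  have path: "past \<omega> = xs \<and> X n \<omega> = s \<longleftrightarrow> length xs = n \<and> (\<forall>i\<le>n. X i \<omega> = (xs @ [s]) ! i)" for \<omega> xs
    by (auto simp: past_def list_eq_iff_nth_eq nth_append le_less)
  have step: "emeasure M {\<omega> \<in> space M. X (Suc n) \<omega> = t \<and> past \<omega> = xs \<and> X n \<omega> = s} =
     ennreal (p s t) * emeasure M {\<omega> \<in> space M. past \<omega> = xs \<and> X n \<omega> = s}" for xs
  proof (cases "length xs = n")
    case True
    let ?s = "\<lambda>i. (xs @ [s]) ! i"
    have eq1: "{\<omega> \<in> space M. past \<omega> = xs \<and> X n \<omega> = s} = {\<omega> \<in> space M. \<forall>i\<le>n. X i \<omega> = ?s i}"
      using True path by auto
    have eq2: "{\<omega> \<in> space M. X (Suc n) \<omega> = t \<and> past \<omega> = xs \<and> X n \<omega> = s} =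
      {\<omega> \<in> space M. X (Suc n) \<omega> = t \<and> (\<forall>i\<le>n. X i \<omega> = ?s i)}"
      using True path by auto
    have "prob {\<omega> \<in> space M. X (Suc n) \<omega> = t \<and> (\<forall>i\<le>n. X i \<omega> = ?s i)} =
          p s t * prob {\<omega> \<in> space M. \<forall>i\<le>n. X i \<omega> = ?s i}"
    proof (cases "prob {\<omega> \<in> space M. \<forall>i\<le>n. X i \<omega> = ?s i} > 0")
      case pos: True
      hence "\<P>(\<omega> in M. X (Suc n) \<omega> = t \<bar> \<forall>i\<le>n. X i \<omega> = ?s i) = p (?s n) t"
        using mc unfolding markov_chain_def by blast
      thus ?thesis using pos True by (simp add: cond_prob_def field_simps nth_append)
    next
      case False
      \<comment> \<open>The definition says nothing about a null history, but then both sides are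
        0.\<close>
      hence z: "prob {\<omega> \<in> space M. \<forall>i\<le>n. X i \<omega> = ?s i} = 0"
        by (simp add: zero_less_measure_iff)
      have "prob {\<omega> \<in> space M. X (Suc n) \<omega> = t \<and> (\<forall>i\<le>n. X i \<omega> = ?s i)} \<le>
            prob {\<omega> \<in> space M. \<forall>i\<le>n. X i \<omega> = ?s i}"
        by (rule finite_measure_mono) auto
      thus ?thesis using z by (simp add: measure_le_0_iff)
    qed
    thus ?thesis unfolding eq1 eq2 using p by (simp add: emeasure_eq_measure ennreal_mult)
  next
    case False
    hence "past \<omega> \<noteq> xs" for \<omega> by (auto simp: past_def)
    thus ?thesis by simp
  qed
  have meas: "{\<omega> \<in> space M. P \<omega> \<and> past \<omega> = xs \<and> X n \<omega> = s} \<in> sets M"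
    if [measurable]: "Measurable.pred M P" for P xs
  proof (cases "length xs = n")
    case True
    hence "{\<omega> \<in> space M. P \<omega> \<and> past \<omega> = xs \<and> X n \<omega> = s} =
      {\<omega> \<in> space M. P \<omega> \<and> (\<forall>i\<le>n. X i \<omega> = (xs @ [s]) ! i)}"
      using path by auto
    thus ?thesis by simp
  next
    case False
    hence "past \<omega> \<noteq> xs" for \<omega> by (auto simp: past_def)
    thus ?thesis by simp
  qed
  have split: "emeasure M {\<omega> \<in> space M. P \<omega> \<and> X n \<omega> = s} =
     (\<integral>\<^sup>+xs. emeasure M {\<omega> \<in> space M. P \<omega> \<and> past \<omega> = xs \<and> X n \<omega> = s} \<partial>count_space UNIV)"
    if P: "Measurable.pred M P" for P
  proof -
    have "{\<omega> \<in> space M. P \<omega> \<and> X n \<omega> = s} =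
      (\<Union>xs. {\<omega> \<in> space M. P \<omega> \<and> past \<omega> = xs \<and> X n \<omega> = s})" by auto
    thus ?thesis using meas[OF P]
      by (auto intro!: emeasure_UN_countable simp: disjoint_family_on_def)
  qed
  show ?thesis
    using split[of "\<lambda>\<omega>. X (Suc n) \<omega> = t"] split[of "\<lambda>_. True"]
    by (simp add: step nn_integral_cmult)
qed

lemma markov_chain_forward:
  fixes X :: "nat \<Rightarrow> 'w \<Rightarrow> 's :: countable"
  assumes mc: "markov_chain M X p" and p: "\<And>s t. 0 \<le> p s t"
    and fin: "finite A" and supp: "\<And>s. s \<notin> A \<Longrightarrow> p s t = 0"
  shows "\<P>(\<omega> in M. X (Suc n) \<omega> = t) = (\<Sum>s\<in>A. p s t * \<P>(\<omega> in M. X n \<omega> = s))"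
proof -
  interpret prob_space M using mc by (simp add: markov_chain_def)
  have [measurable]: "X m \<in> M \<rightarrow>\<^sub>M count_space UNIV" for m
    using mc by (simp add: markov_chain_def)
  have "{\<omega> \<in> space M. X (Suc n) \<omega> = t} = (\<Union>s. {\<omega> \<in> space M. X (Suc n) \<omega> = t \<and> X n \<omega> = s})"
    by auto
  hence "emeasure M {\<omega> \<in> space M. X (Suc n) \<omega> = t} =
    (\<integral>\<^sup>+s. emeasure M {\<omega> \<in> space M. X (Suc n) \<omega> = t \<and> X n \<omega> = s} \<partial>count_space UNIV)"
    by (auto intro!: emeasure_UN_countable simp: disjoint_family_on_def)
  also have "\<dots> = (\<integral>\<^sup>+s. ennreal (p s t) * emeasure M {\<omega> \<in> space M. X n \<omega> = s} \<partial>count_space UNIV)"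
    by (simp add: markov_chain_joint[OF mc p])
  also have "\<dots> = (\<Sum>s\<in>A. ennreal (p s t) * emeasure M {\<omega> \<in> space M. X n \<omega> = s})"
    using fin supp by (intro nn_integral_count_space') auto
  also have "\<dots> = ennreal (\<Sum>s\<in>A. p s t * prob {\<omega> \<in> space M. X n \<omega> = s})"
    using p by (simp add: emeasure_eq_measure flip: ennreal_mult)
  finally show ?thesis
    using p by (simp add: emeasure_eq_measure sum_nonneg)
qed

text \<open>The vertical coefficients belong to the level that the step leaves, \<open>j - 1\<close>
  or \<open>j + 1\<close>; in \<open>fibre_op\<close> they belong to \<open>j\<close> itself.
  \<open>rev_measure\<close> reconciles the two.\<close>

lemma HPHC_forward:
  assumes "HPHC_walk M C"
  defines "q n k j \<equiv> \<P>(\<omega> in M. C n \<omega> = (k, j))"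
  shows "q 0 k j = (if k = 0 \<and> j = 0 then 1 else 0)"
    and "q (Suc n) k j = (1/2 - HPHC_p j) * (q n (k - 1) j + q n (k + 1) j)
           + HPHC_p (j - 1) * q n k (j - 1) + HPHC_p (j + 1) * q n k (j + 1)"
proof -
  have mc: "markov_chain M C HPHC_step" and ae: "AE \<omega> in M. C 0 \<omega> = (0, 0)"
    using assms(1) by (auto simp: HPHC_walk_def)
  interpret prob_space M using mc by (simp add: markov_chain_def)
  have [measurable]: "C m \<in> M \<rightarrow>\<^sub>M count_space UNIV" for m
    using mc by (simp add: markov_chain_def)
  show "q 0 k j = (if k = 0 \<and> j = 0 then 1 else 0)"
  proof (cases "k = 0 \<and> j = 0")
    case True
    thus ?thesis using ae prob_Collect_eq_1[of "\<lambda>\<omega>. C 0 \<omega> = (0,0)"] by (simp add: q_def)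
  next
    case False
    have "AE \<omega> in M. C 0 \<omega> \<noteq> (k, j)" using ae by eventually_elim (use False in auto)
    thus ?thesis using False prob_Collect_eq_0[of "\<lambda>\<omega>. C 0 \<omega> = (k,j)"] by (auto simp: q_def)
  qed
  have "HPHC_step s t \<ge> 0" for s t
    by (cases s; cases t) (auto simp: HPHC_p_def)
  hence "q (Suc n) k j = (\<Sum>s\<in>{(k-1,j),(k+1,j),(k,j-1),(k,j+1)}. HPHC_step s (k,j) * \<P>(\<omega> in M. C n \<omega> = s))"
    unfolding q_def by (intro markov_chain_forward[OF mc]) (auto split: if_splits)
  thus "q (Suc n) k j = (1/2 - HPHC_p j) * (q n (k - 1) j + q n (k + 1) j)
           + HPHC_p (j - 1) * q n k (j - 1) + HPHC_p (j + 1) * q n k (j + 1)"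
    by (simp add: q_def algebra_simps)
qed

section \<open>Fibre operators\<close>

text \<open>The two horizontal moves have total probability \<open>1 - 2 * HPHC_p j\<close> and act
  on frequency \<theta> as multiplication by c = cos \<theta>.\<close>

definition fibre_op :: "real \<Rightarrow> (int \<Rightarrow> real) \<Rightarrow> int \<Rightarrow> real" where
  "fibre_op c f j = (1 - 2 * HPHC_p j) * c * f j + HPHC_p j * (f (j - 1) + f (j + 1))"

definition fibre_iter :: "real \<Rightarrow> nat \<Rightarrow> int \<Rightarrow> real" where
  "fibre_iter c n = (fibre_op c ^^ n) (\<lambda>j. if j = 0 then 1 else 0)"

text \<open>Proportional to 1 / \<open>HPHC_p\<close>, so that every vertical edge has conductance
  1/4, and normalised to 1 at the origin so that it drops out of return probabilities.\<close>

definition rev_measure :: "int \<Rightarrow> real" where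
  "rev_measure j = (if j \<ge> 0 then 1 else 1/2)"

lemma fibre_iter_0: "fibre_iter c 0 j = (if j = 0 then 1 else 0)"
  by (simp add: fibre_iter_def)

lemma fibre_iter_Suc: "fibre_iter c (Suc n) = fibre_op c (fibre_iter c n)"
  by (simp add: fibre_iter_def)

lemma HPHC_p_cases: "HPHC_p j = 1/4 \<or> HPHC_p j = 1/2"
  by (simp add: HPHC_p_def)

lemma detailed_balance: "rev_measure j * HPHC_p j = 1/4"
  by (simp add: rev_measure_def HPHC_p_def)

text \<open>The coefficients 1 - 2p, p, p are nonnegative with sum 1, so this is an average once |c|
  <= 1.\<close>

lemma abs_fibre_op_le:
  assumes c: "\<bar>c\<bar> \<le> 1" and f: "\<And>j. \<bar>f j\<bar> \<le> B"
  shows "\<bar>fibre_op c f j\<bar> \<le> B"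
proof -
  have "\<bar>c * f j\<bar> \<le> 1 * B" unfolding abs_mult using c f by (intro mult_mono) auto
  moreover have "\<bar>f (j - 1)\<bar> \<le> B" "\<bar>f (j + 1)\<bar> \<le> B" using f by auto
  moreover have eq: "fibre_op c f j = (1 - 2 * HPHC_p j) * (c * f j) + HPHC_p j * (f (j - 1) + f (j + 1))"
    by (simp add: fibre_op_def)
  ultimately show ?thesis
    using HPHC_p_cases[of j] unfolding eq by (elim disjE; simp only:; argo)
qed

lemma abs_fibre_iter_le_1:
  assumes "\<bar>c\<bar> \<le> 1"
  shows "\<bar>fibre_iter c n j\<bar> \<le> 1"
  by (induction n arbitrary: j)
     (auto simp: fibre_iter_0 fibre_iter_Suc intro: abs_fibre_op_le[OF assms])

text \<open>One application moves mass by at most one level. This allows all inner products on the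
  vertical line to be finite sums.\<close>

lemma fibre_iter_eq_0: "int n < \<bar>j\<bar> \<Longrightarrow> fibre_iter c n j = 0"
  by (induction n arbitrary: j) (auto simp: fibre_iter_0 fibre_iter_Suc fibre_op_def)

lemma continuous_fibre_iter:
  "continuous_on A (\<lambda>\<theta>. fibre_iter (cos \<theta>) n j)"
  by (induction n arbitrary: j)
     (auto simp: fibre_iter_0 fibre_iter_Suc fibre_op_def intro!: continuous_intros)

lemma HPHC_parity:
  assumes "HPHC_walk M C" "odd (int n + k + j)"
  shows "\<P>(\<omega> in M. C n \<omega> = (k, j)) = 0"
  using assms(2)
proof (induction n arbitrary: k j)
  case 0
  thus ?case by (auto simp: HPHC_forward(1)[OF assms(1)])
next
  case (Suc n)
  have "odd (int n + (k - 1) + j)" "odd (int n + (k + 1) + j)"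
    "odd (int n + k + (j - 1))" "odd (int n + k + (j + 1))"
    using Suc.prems by auto
  with Suc.IH show ?case by (simp add: HPHC_forward(2)[OF assms(1)])
qed

text \<open>
  Fourier transform in the horizontal direction; the weight turns the forward equation
  for the law of the walk into the backward recursion of \<^const>\<open>fibre_iter\<close>.
\<close>

lemma HPHC_prob_eq_integral:
  assumes "HPHC_walk M C"
  shows "\<P>(\<omega> in M. C n \<omega> = (k, j)) =
    rev_measure j / pi * integral {0..pi} (\<lambda>\<theta>. cos (of_int k * \<theta>) * fibre_iter (cos \<theta>) n j)"
proof (induction n arbitrary: k j)
  case 0
  have "integral {0..pi} (\<lambda>\<theta>. cos (of_int k * \<theta>)) = (if k = 0 then pi else 0)"
  proof (cases "k = 0")
    case False
    have "((\<lambda>\<theta>. cos (of_int k * \<theta>)) has_integral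
        sin (of_int k * pi) / of_int k - sin (of_int k * 0) / of_int k) {0..pi}"
      using False
      by (intro fundamental_theorem_of_calculus)
         (auto intro!: derivative_eq_intros simp flip: has_real_derivative_iff_has_vector_derivative)
    moreover have "sin (of_int k * pi) = 0" by (simp add: sin_zero_iff_int2)
    ultimately show ?thesis using False by (simp add: integral_unique)
  qed simp
  thus ?case by (auto simp: HPHC_forward(1)[OF assms] fibre_iter_0 rev_measure_def)
next
  case (Suc n)
  let ?f = "\<lambda>j \<theta>. fibre_iter (cos \<theta>) n j"
  let ?I = "\<lambda>k j. integral {0..pi} (\<lambda>\<theta>. cos (of_int k * \<theta>) * ?f j \<theta>)"
  have int: "((\<lambda>\<theta>. cos (of_int k * \<theta>) * ?f j \<theta>) has_integral ?I k j) {0..pi}" for k j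
    by (intro integrable_integral integrable_continuous_real continuous_intros continuous_fibre_iter)
  have "((\<lambda>\<theta>. (1/2 - HPHC_p j) * (cos (of_int (k - 1) * \<theta>) * ?f j \<theta> + cos (of_int (k + 1) * \<theta>) * ?f j \<theta>)
        + HPHC_p j * (cos (of_int k * \<theta>) * ?f (j - 1) \<theta> + cos (of_int k * \<theta>) * ?f (j + 1) \<theta>))
      has_integral (1/2 - HPHC_p j) * (?I (k - 1) j + ?I (k + 1) j)
        + HPHC_p j * (?I k (j - 1) + ?I k (j + 1))) {0..pi}"
    by (intro has_integral_add has_integral_mult_right int)
  moreover have "cos (of_int (k - 1) * \<theta>) + cos (of_int (k + 1) * \<theta>) = 2 * cos \<theta> * cos (of_int k * \<theta>)" for \<theta> :: real
    by (simp add: algebra_simps cos_add cos_diff)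
  hence "(1/2 - HPHC_p j) * (cos (of_int (k - 1) * \<theta>) * ?f j \<theta> + cos (of_int (k + 1) * \<theta>) * ?f j \<theta>)
        + HPHC_p j * (cos (of_int k * \<theta>) * ?f (j - 1) \<theta> + cos (of_int k * \<theta>) * ?f (j + 1) \<theta>)
      = cos (of_int k * \<theta>) * fibre_iter (cos \<theta>) (Suc n) j" for \<theta>
    by (simp only: distrib_right[symmetric] distrib_left[symmetric] mult.assoc[symmetric] fibre_iter_Suc fibre_op_def)
       (simp add: algebra_simps)
  ultimately have "integral {0..pi} (\<lambda>\<theta>. cos (of_int k * \<theta>) * fibre_iter (cos \<theta>) (Suc n) j) =
      (1/2 - HPHC_p j) * (?I (k - 1) j + ?I (k + 1) j) + HPHC_p j * (?I k (j - 1) + ?I k (j + 1))"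
    by (simp add: integral_unique)
  \<comment> \<open>Detailed balance: the product is 1/4 at every level, so the coefficient of the
    neighbour \<open>i\<close> may be replaced by that of \<open>j\<close>.\<close>
  moreover have "HPHC_p i * (rev_measure i / pi * x) = rev_measure j * HPHC_p j / pi * x" for i x
    using detailed_balance[of i] detailed_balance[of j] by (simp add: field_simps)
  moreover have "(1/2 - p) * (r / pi * A + r / pi * B) + r * p / pi * D + r * p / pi * E =
      r / pi * ((1/2 - p) * (A + B) + p * (D + E))" for p r A B D E :: real
    by (simp add: field_simps)
  ultimately show ?case
    unfolding HPHC_forward(2)[OF assms] Suc.IH by (simp only:)
qed

lemma HPHC_return_eq_integral:
  assumes "HPHC_walk M C"
  shows "\<P>(\<omega> in M. C n \<omega> = (0, 0)) = integral {0..pi} (\<lambda>\<theta>. fibre_iter (cos \<theta>) n 0) / pi"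
  using HPHC_prob_eq_integral[OF assms, of n 0 0] by (simp add: rev_measure_def)

section \<open>Reversibility and the monotonicity of even return probabilities\<close>

lemma sum_int_shift:
  fixes h :: "int \<Rightarrow> real"
  assumes "\<And>j. L < \<bar>j\<bar> + 1 \<Longrightarrow> h j = 0"
  shows "(\<Sum>j\<in>{-L..L}. h (j + 1)) = (\<Sum>j\<in>{-L..L}. h j)"
    and "(\<Sum>j\<in>{-L..L}. h (j - 1)) = (\<Sum>j\<in>{-L..L}. h j)"
proof -
  have "(\<Sum>j\<in>{-L..L}. h (j + 1)) = (\<Sum>j\<in>{-L+1..L+1}. h j)"
    by (rule sum.reindex_bij_witness[of _ "\<lambda>j. j - 1" "\<lambda>j. j + 1"]) auto
  \<comment> \<open>For integers the hypothesis means |j| >= L, so \<open>h\<close> vanishes at the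
    end points too and a shift by one loses nothing.\<close>
  also have "\<dots> = (\<Sum>j\<in>{-L+1..L-1}. h j)"
    by (rule sum.mono_neutral_right) (auto intro!: assms)
  also have "\<dots> = (\<Sum>j\<in>{-L..L}. h j)"
    by (rule sum.mono_neutral_left) (auto intro!: assms)
  finally show "(\<Sum>j\<in>{-L..L}. h (j + 1)) = (\<Sum>j\<in>{-L..L}. h j)" .
  have "(\<Sum>j\<in>{-L..L}. h (j - 1)) = (\<Sum>j\<in>{-L-1..L-1}. h j)"
    by (rule sum.reindex_bij_witness[of _ "\<lambda>j. j + 1" "\<lambda>j. j - 1"]) auto
  also have "\<dots> = (\<Sum>j\<in>{-L+1..L-1}. h j)"
    by (rule sum.mono_neutral_right) (auto intro!: assms)
  also have "\<dots> = (\<Sum>j\<in>{-L..L}. h j)"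
    by (rule sum.mono_neutral_left) (auto intro!: assms)
  finally show "(\<Sum>j\<in>{-L..L}. h (j - 1)) = (\<Sum>j\<in>{-L..L}. h j)" .
qed

text \<open>After weighting, the horizontal part is diagonal and the vertical part is 1/4 times a
  sum of two opposite shifts, which are adjoint to each other.\<close>

lemma fibre_op_self_adjoint:
  assumes f: "\<And>j. L < \<bar>j\<bar> + 1 \<Longrightarrow> f j = 0" and g: "\<And>j. L < \<bar>j\<bar> + 1 \<Longrightarrow> g j = 0"
  shows "(\<Sum>j\<in>{-L..L}. rev_measure j * fibre_op c f j * g j) =
         (\<Sum>j\<in>{-L..L}. rev_measure j * f j * fibre_op c g j)"
proof -
  have rp: "rev_measure j * fibre_op c f j = (rev_measure j - 1/2) * c * f j + 1/4 * (f (j - 1) + f (j + 1))" for f j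
  proof -
    have "rev_measure j * fibre_op c f j = (rev_measure j - 2 * (rev_measure j * HPHC_p j)) * c * f j
        + (rev_measure j * HPHC_p j) * (f (j - 1) + f (j + 1))"
      by (simp add: fibre_op_def algebra_simps)
    thus ?thesis unfolding detailed_balance by simp
  qed
  have s1: "(\<Sum>j\<in>{-L..L}. f (j + 1) * g j) = (\<Sum>j\<in>{-L..L}. f j * g (j - 1))"
    using sum_int_shift(1)[of L "\<lambda>j. f j * g (j - 1)"] f by simp
  have s2: "(\<Sum>j\<in>{-L..L}. f (j - 1) * g j) = (\<Sum>j\<in>{-L..L}. f j * g (j + 1))"
    using sum_int_shift(2)[of L "\<lambda>j. f j * g (j + 1)"] f by simp
  have "(\<Sum>j\<in>{-L..L}. rev_measure j * fibre_op c f j * g j) =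
    (\<Sum>j\<in>{-L..L}. (rev_measure j - 1/2) * c * f j * g j)
     + 1/4 * ((\<Sum>j\<in>{-L..L}. f (j - 1) * g j) + (\<Sum>j\<in>{-L..L}. f (j + 1) * g j))"
    unfolding rp by (simp only: sum.distrib sum_distrib_left distrib_right distrib_left mult.assoc)
  also have "\<dots> = (\<Sum>j\<in>{-L..L}. f j * (rev_measure j * fibre_op c g j))"
    unfolding rp s1 s2
    by (simp only: sum.distrib sum_distrib_left distrib_right distrib_left mult.left_commute mult.assoc)
  finally show ?thesis by (simp add: mult_ac)
qed

text \<open>Jensen's inequality for the averages at each level, followed by invariance of the
  weight: after summation the shifted squares cancel.\<close>

lemma fibre_op_contraction:
  assumes c: "\<bar>c\<bar> \<le> 1" and f: "\<And>j. L < \<bar>j\<bar> + 1 \<Longrightarrow> f j = 0"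
  shows "(\<Sum>j\<in>{-L..L}. rev_measure j * (fibre_op c f j)\<^sup>2) \<le> (\<Sum>j\<in>{-L..L}. rev_measure j * (f j)\<^sup>2)"
proof -
  have "(fibre_op c f j)\<^sup>2 \<le> (1 - 2 * HPHC_p j) * (f j)\<^sup>2 + HPHC_p j * ((f (j - 1))\<^sup>2 + (f (j + 1))\<^sup>2)" for j
  proof -
    have c2: "(c * f j)\<^sup>2 \<le> (f j)\<^sup>2"
      using c by (simp add: power_mult_distrib mult_left_le_one_le abs_square_le_1)
    have q: "(1/2 * x + 1/4 * (y + z))\<^sup>2 \<le> 1/2 * x\<^sup>2 + 1/4 * (y\<^sup>2 + z\<^sup>2)" for x y z :: real
    proof -
      \<comment> \<open>The variance for weights 1/2, 1/4, 1/4, written as the sum of squared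
        differences weighted by the pairwise products of the weights.\<close>
      have "1/2 * x\<^sup>2 + 1/4 * (y\<^sup>2 + z\<^sup>2) - (1/2 * x + 1/4 * (y + z))\<^sup>2 =
        1/8 * (x - y)\<^sup>2 + 1/8 * (x - z)\<^sup>2 + 1/16 * (y - z)\<^sup>2"
        by (simp add: power2_eq_square field_simps)
      moreover have "0 \<le> \<dots>" by simp
      ultimately show ?thesis by linarith
    qed
    have q': "(1/2 * (y + z))\<^sup>2 \<le> 1/2 * (y\<^sup>2 + z\<^sup>2)" for y z :: real
    proof -
      have "1/2 * (y\<^sup>2 + z\<^sup>2) - (1/2 * (y + z))\<^sup>2 = 1/4 * (y - z)\<^sup>2"
        by (simp add: power2_eq_square field_simps)
      moreover have "0 \<le> \<dots>" by simp
      ultimately show ?thesis by linarith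
    qed
    from HPHC_p_cases[of j] show ?thesis
    proof
      assume p: "HPHC_p j = 1/4"
      have "fibre_op c f j = 1/2 * (c * f j) + 1/4 * (f (j - 1) + f (j + 1))"
        unfolding fibre_op_def p by simp
      with q[of "c * f j" "f (j - 1)" "f (j + 1)"] c2 show ?thesis unfolding p by simp
    next
      assume p: "HPHC_p j = 1/2"
      have eq: "fibre_op c f j = 1/2 * (f (j - 1) + f (j + 1))"
        unfolding fibre_op_def p by simp
      show ?thesis using q'[of "f (j - 1)" "f (j + 1)"] unfolding eq p by simp
    qed
  qed
  hence "(\<Sum>j\<in>{-L..L}. rev_measure j * (fibre_op c f j)\<^sup>2) \<le>
    (\<Sum>j\<in>{-L..L}. rev_measure j * ((1 - 2 * HPHC_p j) * (f j)\<^sup>2 + HPHC_p j * ((f (j - 1))\<^sup>2 + (f (j + 1))\<^sup>2)))"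
    by (intro sum_mono mult_left_mono) (auto simp: rev_measure_def)
  also have "rev_measure j * ((1 - 2 * HPHC_p j) * (f j)\<^sup>2 + HPHC_p j * ((f (j - 1))\<^sup>2 + (f (j + 1))\<^sup>2)) =
     rev_measure j * (f j)\<^sup>2 + 1/4 * ((f (j - 1))\<^sup>2 + (f (j + 1))\<^sup>2 - 2 * (f j)\<^sup>2)" for j
    unfolding detailed_balance[of j, symmetric] by (simp add: algebra_simps)
  hence "(\<Sum>j\<in>{-L..L}. rev_measure j * ((1 - 2 * HPHC_p j) * (f j)\<^sup>2 + HPHC_p j * ((f (j - 1))\<^sup>2 + (f (j + 1))\<^sup>2))) =
     (\<Sum>j\<in>{-L..L}. rev_measure j * (f j)\<^sup>2 + 1/4 * ((f (j - 1))\<^sup>2 + (f (j + 1))\<^sup>2 - 2 * (f j)\<^sup>2))"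
    by (simp only:)
  also have "\<dots> = (\<Sum>j\<in>{-L..L}. rev_measure j * (f j)\<^sup>2)
      + 1/4 * ((\<Sum>j\<in>{-L..L}. (f (j - 1))\<^sup>2) + (\<Sum>j\<in>{-L..L}. (f (j + 1))\<^sup>2) - 2 * (\<Sum>j\<in>{-L..L}. (f j)\<^sup>2))"
    by (simp only: sum.distrib sum_subtractf flip: sum_distrib_left)
  also have "\<dots> = (\<Sum>j\<in>{-L..L}. rev_measure j * (f j)\<^sup>2)"
    using sum_int_shift[of L "\<lambda>j. (f j)\<^sup>2"] f by simp
  finally show ?thesis .
qed

text \<open>Self-adjointness moves n of the 2n applications to the other factor of the inner
  product, so an even return value is a squared norm. The bound on \<open>L\<close> keeps all
  iterates up to time 2n away from the edge of the window.\<close>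

lemma fibre_iter_even:
  assumes L: "int (2 * n) + 1 < L"
  shows "fibre_iter c (2 * n) 0 = (\<Sum>j\<in>{-L..L}. rev_measure j * (fibre_iter c n j)\<^sup>2)"
proof -
  let ?Q = "\<lambda>k m. \<Sum>j\<in>{-L..L}. rev_measure j * fibre_iter c k j * fibre_iter c m j"
  have "k \<le> n \<Longrightarrow> ?Q 0 (2 * n) = ?Q k (2 * n - k)" for k
  proof (induction k)
    case (Suc k)
    have "?Q k (2 * n - k) = ?Q k (Suc (2 * n - Suc k))" using Suc.prems by (simp add: Suc_diff_Suc)
    also have "\<dots> = ?Q (Suc k) (2 * n - Suc k)"
      unfolding fibre_iter_Suc using L Suc.prems
      by (intro fibre_op_self_adjoint[symmetric] fibre_iter_eq_0) auto
    finally show ?case using Suc by simp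
  qed simp
  from this[of n] have "?Q 0 (2 * n) = ?Q n n" by simp
  moreover have "?Q 0 (2 * n) = (\<Sum>j\<in>{-L..L}. if j = 0 then fibre_iter c (2 * n) 0 else 0)"
    by (intro sum.cong) (auto simp: fibre_iter_0 rev_measure_def)
  hence "?Q 0 (2 * n) = fibre_iter c (2 * n) 0" using L by simp
  ultimately show ?thesis by (simp add: power2_eq_square mult.assoc)
qed

lemma decseq_fibre_iter_even:
  assumes "\<bar>c\<bar> \<le> 1"
  shows "decseq (\<lambda>n. fibre_iter c (2 * n) 0)"
proof (rule decseq_SucI)
  fix n
  \<comment> \<open>Just above 2 (n + 1) + 1, so that one window serves both times n and n +
    1.\<close>
  define L where "L = 2 * int n + 4"
  have "fibre_iter c (2 * Suc n) 0 = (\<Sum>j\<in>{-L..L}. rev_measure j * (fibre_op c (fibre_iter c n) j)\<^sup>2)"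
    unfolding fibre_iter_Suc[symmetric] by (rule fibre_iter_even) (simp add: L_def)
  also have "\<dots> \<le> (\<Sum>j\<in>{-L..L}. rev_measure j * (fibre_iter c n j)\<^sup>2)"
    using assms by (intro fibre_op_contraction) (auto intro!: fibre_iter_eq_0 simp: L_def)
  also have "\<dots> = fibre_iter c (2 * n) 0"
    by (rule fibre_iter_even[symmetric]) (simp add: L_def)
  finally show "fibre_iter c (2 * Suc n) 0 \<le> fibre_iter c (2 * n) 0" .
qed

lemma decseq_HPHC_return:
  assumes "HPHC_walk M C"
  shows "decseq (\<lambda>n. \<P>(\<omega> in M. C (2 * n) \<omega> = (0, 0)))"
  unfolding HPHC_return_eq_integral[OF assms]
  using decseq_fibre_iter_even[OF abs_cos_le_one]
  by (intro decseq_SucI divide_right_mono integral_le integrable_continuous_real continuous_fibre_iter)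
     (auto simp: decseq_Suc_iff)

section \<open>Green functions\<close>

text \<open>Iterating the resolvent equation leaves the remainder z^n T^n g with T =
  \<open>fibre_op c\<close>, at most K z^n in absolute value. Hence any bounded solution is the
  Neumann series, and a guessed Green function only has to be verified.\<close>

lemma fibre_resolvent_sums:
  assumes c: "\<bar>c\<bar> \<le> 1" and z: "0 < z" "z < 1"
    and bound: "\<And>j. \<bar>g j\<bar> \<le> K"
    and eq: "\<And>j. g j = (if j = 0 then 1 else 0) + z * fibre_op c g j"
  shows "(\<lambda>n. fibre_iter c n j * z ^ n) sums g j"
proof -
  define h where "h n = (fibre_op c ^^ n) g" for n
  have h0: "h 0 = g" and hS: "h (Suc n) = fibre_op c (h n)" for n by (simp_all add: h_def)
  have h_bound: "\<bar>h n j\<bar> \<le> K" for n j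
    by (induction n arbitrary: j) (auto simp: h0 hS intro: bound abs_fibre_op_le[OF c])
  have h_eq: "h n j = fibre_iter c n j + z * h (Suc n) j" for n j
  proof (induction n arbitrary: j)
    case 0
    show ?case using eq[of j] by (simp add: h0 hS fibre_iter_0)
  next
    case (Suc n)
    have "(\<lambda>j. fibre_iter c n j + z * h (Suc n) j) = h n" using Suc by (intro ext) simp
    hence "h (Suc n) j = fibre_op c (\<lambda>j. fibre_iter c n j + z * h (Suc n) j) j"
      by (simp only: hS[of n])
    also have "\<dots> = fibre_iter c (Suc n) j + z * h (Suc (Suc n)) j"
      unfolding hS[of "Suc n"] fibre_iter_Suc by (simp add: fibre_op_def algebra_simps)
    finally show ?case .
  qed
  have partial: "(\<Sum>k<n. fibre_iter c k j * z ^ k) = g j - z ^ n * h n j" for n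
  proof (induction n)
    case (Suc n)
    show ?case using Suc h_eq[of n j] by (simp add: algebra_simps)
  qed (simp add: h0)
  have "(\<lambda>n. z ^ n * h n j) \<longlonglongrightarrow> 0"
  proof (rule Lim_null_comparison)
    show "eventually (\<lambda>n. norm (z ^ n * h n j) \<le> z ^ n * K) sequentially"
      using h_bound z by (intro always_eventually allI) (auto simp: abs_mult intro!: mult_left_mono)
    show "(\<lambda>n. z ^ n * K) \<longlonglongrightarrow> 0"
      using z by (intro tendsto_mult_left_zero LIMSEQ_realpow_zero) auto
  qed
  hence "(\<lambda>n. g j - z ^ n * h n j) \<longlonglongrightarrow> g j - 0" by (intro tendsto_intros)
  thus ?thesis by (simp add: sums_def partial)
qed

text \<open>A quarter of the discriminant of z a^2 - 2 (2 - z c) a + z, the quadratic for the decay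
  rate in the upper half-plane.\<close>

definition disc_up :: "real \<Rightarrow> real \<Rightarrow> real" where
  "disc_up z c = (2 - z * c)\<^sup>2 - z\<^sup>2"

text \<open>The resolvent equation at level 0 reads G (4 - 2 z c - z a - z b) = 4 for decay rates a
  above and b below; inserting the roots turns the bracket into this expression.\<close>

definition green_denom :: "real \<Rightarrow> real \<Rightarrow> real" where
  "green_denom z c = 1 - z * c + sqrt (disc_up z c) + sqrt (1 - z\<^sup>2)"

text \<open>The first factor isolates what vanishes as z and c tend to 1; the second tends to
  2.\<close>

lemma disc_up_eq: "disc_up z c = (2 * (1 - z) + z * (1 - c)) * (2 - z * c + z)"
  by (simp add: disc_up_def power2_eq_square algebra_simps)

lemma mult_le_of_abs_le_1:
  fixes z c :: real
  assumes "\<bar>c\<bar> \<le> 1" "0 < z"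
  shows "z * c \<le> z" "- z \<le> z * c"
  using assms mult_left_mono[of c 1 z] mult_left_mono[of "-1" c z] by auto

lemma disc_up_pos:
  assumes "\<bar>c\<bar> \<le> 1" "0 < z" "z < 1"
  shows "disc_up z c > 0"
  unfolding disc_up_eq using mult_le_of_abs_le_1[OF assms(1,2)] assms
  by (intro mult_pos_pos add_pos_nonneg mult_nonneg_nonneg) linarith+

lemma green_denom_pos:
  assumes "\<bar>c\<bar> \<le> 1" "0 < z" "z < 1"
  shows "green_denom z c > 0"
proof -
  have "z\<^sup>2 < 1" using assms by (simp add: power_less_one_iff abs_square_less_1)
  moreover have "sqrt (disc_up z c) > 0" using disc_up_pos[OF assms] by simp
  ultimately show ?thesis
    unfolding green_denom_def using mult_le_of_abs_le_1[OF assms(1,2)] assms(3)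
    by (smt (verit) real_sqrt_ge_zero)
qed

text \<open>
  The Green function decays geometrically in both half-planes; the two rates are the roots in the
  unit disc of \<open>z a\<^sup>2 - 2 (2 - z c) a + z = 0\<close> (upper) and \<open>z b\<^sup>2 - 2 b + z = 0\<close> (lower).
\<close>

lemma fibre_green_sums:
  assumes c: "\<bar>c\<bar> \<le> 1" and z: "0 < z" "z < 1"
  shows "(\<lambda>n. fibre_iter c n 0 * z ^ n) sums (4 / green_denom z c)"
proof -
  define A where "A = sqrt (disc_up z c)"
  define B where "B = sqrt (1 - z\<^sup>2)"
  define G where "G = 4 / green_denom z c"
  define a where "a = (2 - z * c - A) / z"
  define b where "b = (1 - B) / z"
  define g where "g j = (if j \<ge> 0 then G * a ^ nat j else G * b ^ nat (- j))" for j
  note zc = mult_le_of_abs_le_1[OF c z(1)]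
  have z2: "z\<^sup>2 < 1" using z by (simp add: power_less_one_iff abs_square_less_1)
  have A2: "A\<^sup>2 = (2 - z * c)\<^sup>2 - z\<^sup>2"
    using disc_up_pos[OF c z] by (simp add: A_def disc_up_def)
  have B2: "B\<^sup>2 = 1 - z\<^sup>2" using z2 by (simp add: B_def)
  have A0: "A > 0" using disc_up_pos[OF c z] by (simp add: A_def)
  have B0: "B \<ge> 0" using z2 by (simp add: B_def)
  have D: "green_denom z c = 1 - z * c + A + B" by (simp add: green_denom_def A_def B_def)
  have G: "G * (1 - z * c + A + B) = 4" 
  proof -
    have "G * green_denom z c = 4" using green_denom_pos[OF c z] by (simp add: G_def)
    thus ?thesis unfolding D .
  qed
  have a_root: "a = z * (c / 2 * a + 1/4 * (a\<^sup>2 + 1))"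
  proof -
    have "(2 - z * c - A)\<^sup>2 + z\<^sup>2 = 2 * (2 - z * c) * (2 - z * c - A)"
      using A2 by (simp add: power2_eq_square algebra_simps)
    moreover have "a * z = 2 - z * c - A" using z by (simp add: a_def)
    ultimately have "(a * z)\<^sup>2 + z\<^sup>2 = 2 * (2 - z * c) * (a * z)" by simp
    hence "z * (z * a\<^sup>2 + z) = z * (2 * (2 - z * c) * a)"
      by (simp add: power2_eq_square algebra_simps)
    hence "z * a\<^sup>2 + z = 2 * (2 - z * c) * a" using z by simp
    thus ?thesis by (simp add: algebra_simps)
  qed
  have b_root: "b = z * (1/2 * (b\<^sup>2 + 1))"
  proof -
    have "(1 - B)\<^sup>2 + z\<^sup>2 = 2 * (1 - B)"
      using B2 by (simp add: power2_eq_square algebra_simps)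
    moreover have "b * z = 1 - B" using z by (simp add: b_def)
    ultimately have "(b * z)\<^sup>2 + z\<^sup>2 = 2 * (b * z)" by simp
    hence "z * (z * b\<^sup>2 + z) = z * (2 * b)"
      by (simp add: power2_eq_square algebra_simps)
    hence "z * b\<^sup>2 + z = 2 * b" using z by simp
    thus ?thesis by (simp add: algebra_simps)
  qed
  \<comment> \<open>The minus sign before the square root selects the root in [0, 1], which keeps
    \<open>g\<close> bounded as \<open>fibre_resolvent_sums\<close> requires.\<close>
  have a01: "0 \<le> a" "a \<le> 1"
  proof -
    have "A\<^sup>2 \<le> (2 - z * c)\<^sup>2" using A2 by simp
    hence "A \<le> 2 - z * c" by (rule power2_le_imp_le) (use zc z in linarith)
    thus "0 \<le> a" using z by (simp add: a_def)
    have "A\<^sup>2 - (2 - z * c - z)\<^sup>2 = 2 * z * (2 - z * c - z)"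
      unfolding A2 by (simp add: power2_eq_square algebra_simps)
    moreover have "0 \<le> 2 * z * (2 - z * c - z)" by (intro mult_nonneg_nonneg) (use zc z in linarith)+
    ultimately have "(2 - z * c - z)\<^sup>2 \<le> A\<^sup>2" by linarith
    hence "2 - z * c - z \<le> A" using A0 by (rule power2_le_imp_le[OF _ less_imp_le])
    thus "a \<le> 1" using z by (simp add: a_def field_simps)
  qed
  have b01: "0 \<le> b" "b \<le> 1"
  proof -
    have "B \<le> 1" unfolding B_def by simp
    thus "0 \<le> b" using z by (simp add: b_def)
    have "B\<^sup>2 - (1 - z)\<^sup>2 = 2 * z * (1 - z)"
      unfolding B2 by (simp add: power2_eq_square algebra_simps)
    moreover have "0 \<le> 2 * z * (1 - z)" using z by (intro mult_nonneg_nonneg) auto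
    ultimately have "(1 - z)\<^sup>2 \<le> B\<^sup>2" by linarith
    hence "1 - z \<le> B" using B0 by (rule power2_le_imp_le)
    thus "b \<le> 1" using z by (simp add: b_def field_simps)
  qed
  have "(\<lambda>n. fibre_iter c n 0 * z ^ n) sums g 0"
  proof (rule fibre_resolvent_sums[OF c z])
    fix j
    have "\<bar>a ^ n\<bar> \<le> 1" "\<bar>b ^ n\<bar> \<le> 1" for n
      using a01 b01 by (auto intro: power_le_one)
    thus "\<bar>g j\<bar> \<le> \<bar>G\<bar> * 1"
      unfolding g_def abs_mult by (auto simp: abs_mult intro!: mult_left_le)
    consider "j = 0" | n where "j = int (Suc n)" | n where "j = - int (Suc n)"
    proof (cases j rule: int_cases2)
      case (nonneg m)
      thus ?thesis using that by (cases m) auto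
    next
      case (nonpos m)
      thus ?thesis using that by (cases m) auto
    qed
    thus "g j = (if j = 0 then 1 else 0) + z * fibre_op c g j"
    proof cases
      case 1
      have az: "z * a = 2 - z * c - A" and bz: "z * b = 1 - B" using z by (simp_all add: a_def b_def)
      have "4 * (1 + z * (c / 2 * G + 1/4 * (G * b + G * a))) = 4 + G * (2 * (z * c) + z * a + z * b)"
        by (simp add: algebra_simps)
      also have "\<dots> = G * (1 - z * c + A + B) + G * (2 * (z * c) + z * a + z * b)"
        unfolding G ..
      also have "\<dots> = 4 * G" unfolding az bz by (simp add: algebra_simps)
      finally show ?thesis using 1 by (simp add: fibre_op_def g_def HPHC_p_def)
    next
      case (2 n)
      have "z * fibre_op c g j = G * a ^ n * (z * (c / 2 * a + 1/4 * (a\<^sup>2 + 1)))"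
        using 2 by (simp add: fibre_op_def g_def HPHC_p_def nat_add_distrib power2_eq_square algebra_simps)
      also have "\<dots> = G * a ^ n * a" by (simp only: a_root[symmetric])
      finally show ?thesis using 2 by (simp add: g_def nat_add_distrib)
    next
      case (3 n)
      \<comment> \<open>For n = 0 this neighbour is the origin, which \<open>g\<close> assigns to
        the upper branch; both branches equal \<open>G\<close> there.\<close>
      have g3: "g (j + 1) = G * b ^ n"
        using 3 by (cases n) (auto simp: g_def nat_add_distrib)
      have g3': "g (j - 1) = G * b ^ (n + 2)" "g j = G * b ^ (n + 1)"
        using 3 by (auto simp: g_def nat_add_distrib)
      have "z * fibre_op c g j = G * b ^ n * (z * (1/2 * (b\<^sup>2 + 1)))"
        unfolding fibre_op_def g3 g3' using 3
        by (simp add: HPHC_p_def power2_eq_square algebra_simps)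
      also have "\<dots> = G * b ^ n * b" by (simp only: b_root[symmetric])
      also have "\<dots> = g j" unfolding g3' by simp
      finally show ?thesis using 3 by simp
    qed
  qed
  thus ?thesis by (simp add: g_def G_def)
qed

section \<open>The differentiated Green function and its integral over frequencies\<close>

definition green_deriv :: "real \<Rightarrow> real \<Rightarrow> real" where
  "green_deriv z c = 4 * (c + ((2 - z * c) * c + z) / sqrt (disc_up z c) + z / sqrt (1 - z\<^sup>2)) / (green_denom z c)\<^sup>2"

lemma green_has_derivative:
  assumes c: "\<bar>c\<bar> \<le> 1" and z: "0 < z" "z < 1"
  shows "((\<lambda>z. 4 / green_denom z c) has_real_derivative green_deriv z c) (at z)"
proof -
  have z2: "0 < 1 - z\<^sup>2" using z by (simp add: power_less_one_iff abs_square_less_1)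
  note pos = disc_up_pos[OF c z] green_denom_pos[OF c z]
  have dd: "((\<lambda>z. disc_up z c) has_real_derivative - 2 * ((2 - z * c) * c + z)) (at z)"
    unfolding disc_up_def by (auto intro!: derivative_eq_intros simp: algebra_simps)
  have "((\<lambda>z. sqrt (disc_up z c)) has_real_derivative - (((2 - z * c) * c + z) / sqrt (disc_up z c))) (at z)"
    by (rule DERIV_cong[OF DERIV_chain2[OF DERIV_real_sqrt dd]]) (use pos in \<open>auto simp: field_simps\<close>)
  moreover have "((\<lambda>z. sqrt (1 - z\<^sup>2)) has_real_derivative - (z / sqrt (1 - z\<^sup>2))) (at z)"
    by (rule derivative_eq_intros refl | use z2 in \<open>simp add: field_simps\<close>)+
  moreover have "((\<lambda>z. 1 - z * c) has_real_derivative - c) (at z)"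
    by (auto intro!: derivative_eq_intros)
  ultimately have "((\<lambda>z. green_denom z c) has_real_derivative
     - c + - (((2 - z * c) * c + z) / sqrt (disc_up z c)) + - (z / sqrt (1 - z\<^sup>2))) (at z)"
    unfolding green_denom_def by (intro DERIV_add)
  hence "((\<lambda>z. green_denom z c) has_real_derivative
     - (c + ((2 - z * c) * c + z) / sqrt (disc_up z c) + z / sqrt (1 - z\<^sup>2))) (at z)"
    by (simp add: algebra_simps)
  from DERIV_divide[OF DERIV_const[of 4] this] show ?thesis
    using pos(2) unfolding green_deriv_def
    by (simp only: power2_eq_square mult_zero_left diff_0 mult_minus_right minus_minus less_imp_neq[symmetric] not_False_eq_True)
qed

lemma fibre_green_deriv_sums:
  assumes c: "\<bar>c\<bar> \<le> 1" and z: "0 < z" "z < 1"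
  shows "(\<lambda>n. real n * fibre_iter c n 0 * z ^ n) sums (z * green_deriv z c)"
proof -
  let ?f = "\<lambda>n. fibre_iter c n 0"
  have sm: "summable (\<lambda>n. ?f n * x ^ n)" if "norm x < 1" for x :: real
    using abs_fibre_iter_le_1[OF c] that
    by (intro summable_comparison_test'[OF summable_geometric[of "\<bar>x\<bar>"]])
       (auto simp: abs_mult power_abs intro!: mult_left_le_one_le)
  have "((\<lambda>x. \<Sum>n. ?f n * x ^ n) has_real_derivative (\<Sum>n. diffs ?f n * z ^ n)) (at z)"
    by (rule termdiffs_strong'[OF sm]) (use z in auto)
  moreover have "eventually (\<lambda>x. 4 / green_denom x c = (\<Sum>n. ?f n * x ^ n)) (nhds z)"
  proof (rule eventually_mono)
    show "eventually (\<lambda>x. x \<in> {0<..<1}) (nhds z)" using z by (intro eventually_nhds_in_open) auto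
    show "4 / green_denom x c = (\<Sum>n. ?f n * x ^ n)" if "x \<in> {0<..<1}" for x
      using fibre_green_sums[OF c, of x] that by (simp add: sums_iff)
  qed
  hence "((\<lambda>x. \<Sum>n. ?f n * x ^ n) has_real_derivative green_deriv z c) (at z)"
    by (rule iffD1[OF DERIV_cong_ev[OF refl _ refl] green_has_derivative[OF c z]])
  ultimately have "(\<Sum>n. diffs ?f n * z ^ n) = green_deriv z c" by (rule DERIV_unique)
  moreover have "summable (\<lambda>n. diffs ?f n * z ^ n)"
    by (rule termdiff_converges[OF _ sm]) (use z in auto)
  ultimately have "(\<lambda>n. diffs ?f n * z ^ n) sums green_deriv z c" by (simp add: sums_iff)
  from sums_mult[OF this, of z]
  have "(\<lambda>n. real (Suc n) * ?f (Suc n) * z ^ Suc n) sums (z * green_deriv z c)"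
    by (simp add: diffs_def mult_ac)
  \<comment> \<open>The term at index 0 carries the factor 0, so undoing the index shift adds
    nothing.\<close>
  thus ?thesis by (subst (asm) sums_Suc_iff) simp
qed

lemma HPHC_return_deriv_sums:
  assumes walk: "HPHC_walk M C" and z: "0 < z" "z < 1"
  shows "(\<lambda>n. real n * \<P>(\<omega> in M. C n \<omega> = (0, 0)) * z ^ n) sums
    (z / pi * integral {0..pi} (\<lambda>\<theta>. green_deriv z (cos \<theta>)))"
proof -
  let ?t = "\<lambda>n \<theta>. real n * fibre_iter (cos \<theta>) n 0 * z ^ n"
  have "summable (\<lambda>n. diffs (\<lambda>_. 1) n * z ^ n)"
    by (rule termdiff_converges[where K = 1]) (use z in \<open>auto intro: summable_geometric\<close>)
  hence "summable (\<lambda>n. z * (diffs (\<lambda>_. 1) n * z ^ n))" by (rule summable_mult)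
  hence sm: "summable (\<lambda>n. real n * z ^ n)"
    by (subst summable_Suc_iff[symmetric]) (simp add: diffs_def mult_ac)
  \<comment> \<open>The majorant n z^n does not depend on \<theta>, so sum and integral may be
    interchanged.\<close>
  have "uniform_limit {0..pi} (\<lambda>n \<theta>. \<Sum>i<n. ?t i \<theta>) (\<lambda>\<theta>. suminf (\<lambda>i. ?t i \<theta>)) sequentially"
  proof (rule Weierstrass_m_test[OF _ sm])
    fix n \<theta>
    show "norm (?t n \<theta>) \<le> real n * z ^ n"
      using abs_fibre_iter_le_1[OF abs_cos_le_one[of \<theta>], of n 0] z
      by (auto simp: abs_mult intro!: mult_right_mono mult_left_le)
  qed
  moreover have "suminf (\<lambda>i. ?t i \<theta>) = z * green_deriv z (cos \<theta>)" for \<theta>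
    using fibre_green_deriv_sums[OF abs_cos_le_one z] by (simp add: sums_iff)
  ultimately have lim: "uniform_limit (cbox 0 pi) (\<lambda>n \<theta>. \<Sum>i<n. ?t i \<theta>) (\<lambda>\<theta>. z * green_deriv z (cos \<theta>)) sequentially"
    by simp
  have cont: "continuous_on (cbox 0 pi) (\<lambda>\<theta>. \<Sum>i<n. ?t i \<theta>)" for n
    by (intro continuous_intros continuous_fibre_iter)
  obtain I J where IJ: "\<And>n. ((\<lambda>\<theta>. \<Sum>i<n. ?t i \<theta>) has_integral I n) (cbox 0 pi)"
      "((\<lambda>\<theta>. z * green_deriv z (cos \<theta>)) has_integral J) (cbox 0 pi)" "I \<longlonglongrightarrow> J"
    by (rule uniform_limit_integral_cbox[OF lim cont sequentially_bot]) (rule that)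
  have "I = (\<lambda>n. \<Sum>i<n. integral {0..pi} (?t i))"
  proof
    fix n show "I n = (\<Sum>i<n. integral {0..pi} (?t i))"
    using IJ(1)[of n] by (subst integral_sum[symmetric])
      (auto intro!: integrable_continuous_real continuous_intros continuous_fibre_iter simp: integral_unique)
  qed
  moreover have "J = z * integral {0..pi} (\<lambda>\<theta>. green_deriv z (cos \<theta>))"
    using integral_unique[OF IJ(2)] by simp
  ultimately have "(\<lambda>n. integral {0..pi} (?t n)) sums (z * integral {0..pi} (\<lambda>\<theta>. green_deriv z (cos \<theta>)))"
    using IJ(3) unfolding sums_def by (simp only:)
  from sums_divide[OF this, of pi] show ?thesis
    by (simp add: HPHC_return_eq_integral[OF walk] mult_ac)
qed

section \<open>The singularity at 1\<close>

lemma tendsto_one_minus_cos: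
  fixes t :: real
  shows "((\<lambda>s. (1 - cos (s * t)) / s\<^sup>2) \<longlongrightarrow> t\<^sup>2 / 2) (at 0)"
proof -
  have "((\<lambda>s. sin (s * (t / 2))) has_real_derivative t / 2) (at 0)"
    by (auto intro!: derivative_eq_intros)
  hence "((\<lambda>s. sin (s * (t / 2)) / s) \<longlongrightarrow> t / 2) (at 0)"
    unfolding DERIV_def by simp
  from tendsto_mult[OF tendsto_const tendsto_power[OF this]]
  have "((\<lambda>s. 2 * (sin (s * (t / 2)) / s)\<^sup>2) \<longlongrightarrow> 2 * (t / 2)\<^sup>2) (at 0)" .
  moreover have "(\<lambda>s. 2 * (sin (s * (t / 2)) / s)\<^sup>2) = (\<lambda>s. (1 - cos (s * t)) / s\<^sup>2)"
  proof
    fix s show "2 * (sin (s * (t / 2)) / s)\<^sup>2 = (1 - cos (s * t)) / s\<^sup>2"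
      using cos_double_sin[of "s * (t / 2)"] by (simp add: power_divide)
  qed
  moreover have "2 * (t / 2)\<^sup>2 = t\<^sup>2 / 2" by (simp add: power2_eq_square)
  ultimately show ?thesis by (simp only:)
qed

text \<open>From 1 - cos x = 2 sin^2 (x/2) and the crude bound sin y >= y/3 on [0, pi/2], which
  gives 2 (x/6)^2. Up to pi/3 the derivative cos is at least 1/2; beyond it sin is at least sqrt 3 /
  2 >= 2/3, while y < 2.\<close>

lemma one_minus_cos_ge:
  assumes "0 \<le> x" "x \<le> pi"
  shows "x\<^sup>2 / 18 \<le> 1 - cos x"
proof -
  define y where "y = x / 2"
  have y: "0 \<le> y" "y \<le> pi / 2" using assms by (simp_all add: y_def)
  have "y / 3 \<le> sin y"
  proof (cases "y \<le> pi / 3")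
    case True
    have "sin 0 - 0 / 3 \<le> sin y - y / 3"
    proof (rule DERIV_nonneg_imp_nondecreasing[OF y(1)])
      fix u assume u: "0 \<le> u" "u \<le> y"
      have "cos (pi / 3) \<le> cos u" using u True pi_gt_zero by (intro cos_monotone_0_pi_le) auto
      hence "0 \<le> cos u - 1 / 3" by (simp add: cos_60)
      moreover have "((\<lambda>u. sin u - u / 3) has_real_derivative cos u - 1 / 3) (at u)"
        by (auto intro!: derivative_eq_intros)
      ultimately show "\<exists>D. ((\<lambda>u. sin u - u / 3) has_real_derivative D) (at u) \<and> 0 \<le> D" by blast
    qed
    thus ?thesis by simp
  next
    case False
    have "sin (pi / 3) \<le> sin y" using False y by (intro sin_monotone_2pi_le) auto
    moreover have "2 / 3 \<le> sqrt 3 / 2"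
      using real_le_rsqrt[of "4 / 3" 3] by (simp add: power2_eq_square)
    ultimately show ?thesis using y pi_less_4 by (simp add: sin_60)
  qed
  hence "(y / 3)\<^sup>2 \<le> (sin y)\<^sup>2" using y by (intro power_mono) auto
  moreover have "1 - cos x = 2 * (sin y)\<^sup>2" using cos_double_sin[of y] by (simp add: y_def)
  ultimately show ?thesis by (simp add: y_def power_divide)
qed

text \<open>The substitution \<open>\<theta> = s t\<close> with \<open>s = \<surd>(1 - z)\<close>.\<close>

definition green_scaled :: "real \<Rightarrow> real \<Rightarrow> real" where
  "green_scaled s t = s ^ 3 * green_deriv (1 - s\<^sup>2) (cos (s * t))"

text \<open>The roots \<open>sqrt (4 + t\<^sup>2)\<close> and \<open>sqrt 2\<close> are the limits
  of \<open>sqrt (disc_up z c) / s\<close> and \<open>sqrt (1 - z\<^sup>2) / s\<close>.\<close>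

definition green_limit :: "real \<Rightarrow> real" where
  "green_limit t = 4 * (2 / sqrt (4 + t\<^sup>2) + 1 / sqrt 2) / (sqrt (4 + t\<^sup>2) + sqrt 2)\<^sup>2"

lemma tendsto_green_scaled:
  "((\<lambda>s. green_scaled s t) \<longlongrightarrow> green_limit t) (at_right 0)"
proof -
  define c where "c s = cos (s * t)" for s
  define z where "z s = 1 - s\<^sup>2" for s :: real
  define q where "q s = (1 - c s) / s\<^sup>2" for s
  have near: "eventually (\<lambda>s::real. s \<in> {0<..<1}) (at_right 0)"
    by (rule eventually_at_rightI[of 0 1]) auto
  have "(q \<longlongrightarrow> t\<^sup>2 / 2) (at 0)"
    unfolding q_def c_def by (rule tendsto_one_minus_cos)
  hence q: "(q \<longlongrightarrow> t\<^sup>2 / 2) (at_right 0)"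
    by (rule tendsto_within_subset) simp
  have s: "((\<lambda>s::real. s) \<longlongrightarrow> 0) (at_right 0)" by (rule tendsto_ident_at)
  have c: "(c \<longlongrightarrow> 1) (at_right 0)" unfolding c_def by (auto intro!: tendsto_eq_intros)
  have z: "(z \<longlongrightarrow> 1) (at_right 0)" unfolding z_def by (auto intro!: tendsto_eq_intros)
  \<comment> \<open>\<open>A\<close> and \<open>B\<close> are the two square roots of
    \<open>green_denom\<close> with their factor s removed. The numerator then has order 1/s and the
    squared denominator order s^2, exactly offset by s^3.\<close>
  define A where "A s = sqrt ((2 + z s * q s) * (2 - z s * c s + z s))" for s
  define B where "B s = sqrt (2 - s\<^sup>2)" for s :: real
  have "(A \<longlongrightarrow> sqrt ((2 + 1 * (t\<^sup>2 / 2)) * (2 - 1 * 1 + 1))) (at_right 0)"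
    unfolding A_def by (intro tendsto_intros q c z)
  hence A: "(A \<longlongrightarrow> sqrt (4 + t\<^sup>2)) (at_right 0)" by (simp add: algebra_simps)
  have B: "(B \<longlongrightarrow> sqrt 2) (at_right 0)"
    unfolding B_def by (auto intro!: tendsto_eq_intros)
  have R: "sqrt (4 + t\<^sup>2) > 0" by (simp add: add_pos_nonneg)
  hence "sqrt (4 + t\<^sup>2) \<noteq> 0" "(0 * (1 * (t\<^sup>2 / 2) + 1) + sqrt (4 + t\<^sup>2) + sqrt 2)\<^sup>2 \<noteq> 0" "sqrt 2 \<noteq> (0 :: real)"
    using add_pos_pos[OF R, of "sqrt 2"] by auto
  hence "((\<lambda>s. 4 * (s * c s + ((2 - z s * c s) * c s + z s) / A s + z s / B s)
       / (s * (z s * q s + 1) + A s + B s)\<^sup>2) \<longlongrightarrow>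
       4 * (0 * 1 + ((2 - 1 * 1) * 1 + 1) / sqrt (4 + t\<^sup>2) + 1 / sqrt 2)
       / (0 * (1 * (t\<^sup>2 / 2) + 1) + sqrt (4 + t\<^sup>2) + sqrt 2)\<^sup>2) (at_right 0)"
    by (intro tendsto_intros A B q c z s)
  moreover have "eventually (\<lambda>s. 4 * (s * c s + ((2 - z s * c s) * c s + z s) / A s + z s / B s)
       / (s * (z s * q s + 1) + A s + B s)\<^sup>2 = green_scaled s t) (at_right 0)"
    using near
  proof eventually_elim
    case (elim s)
    define n where "n = (2 - z s * c s) * c s + z s"
    have s0: "s > 0" using elim by simp
    have q': "1 - c s = s\<^sup>2 * q s" using s0 by (simp add: q_def)
    have z': "1 - z s = s\<^sup>2" by (simp add: z_def)
    have A': "sqrt (disc_up (z s) (c s)) = s * A s"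
    proof -
      have "disc_up (z s) (c s) = s\<^sup>2 * ((2 + z s * q s) * (2 - z s * c s + z s))"
        unfolding disc_up_eq q' z' by (simp add: algebra_simps)
      thus ?thesis using s0 by (simp add: A_def real_sqrt_mult)
    qed
    have B': "sqrt (1 - (z s)\<^sup>2) = s * B s"
    proof -
      have "1 - (z s)\<^sup>2 = s\<^sup>2 * (2 - s\<^sup>2)" by (simp add: z_def power2_eq_square algebra_simps)
      thus ?thesis using s0 by (simp add: B_def real_sqrt_mult)
    qed
    have "1 - z s * c s = z s * (1 - c s) + (1 - z s)" by (simp add: algebra_simps)
    hence zc: "1 - z s * c s = s * (s * (z s * q s + 1))"
      unfolding q' z' by (simp add: power2_eq_square algebra_simps)
    have D': "green_denom (z s) (c s) = s * (s * (z s * q s + 1) + A s + B s)"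
      unfolding green_denom_def A' B' zc by (simp add: algebra_simps)
    have "green_scaled s t = s ^ 3 * (4 * (c s + n / (s * A s) + z s / (s * B s)) /
        (s * (s * (z s * q s + 1) + A s + B s))\<^sup>2)"
    proof -
      have "green_scaled s t = s ^ 3 * green_deriv (z s) (c s)"
        by (simp add: green_scaled_def z_def c_def)
      thus ?thesis unfolding green_deriv_def D' A' B' n_def .
    qed
    also have "\<dots> = s * (4 * (c s + n / (s * A s) + z s / (s * B s))) /
        (s * (z s * q s + 1) + A s + B s)\<^sup>2"
      unfolding power_mult_distrib using s0 by (simp add: power3_eq_cube power2_eq_square)
    also have "s * (4 * (c s + n / (s * A s) + z s / (s * B s))) = 4 * (s * c s + n / A s + z s / B s)"
      using s0 by (simp add: algebra_simps)
    finally show ?case by (simp add: n_def)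
  qed
  ultimately have "((\<lambda>s. green_scaled s t) \<longlongrightarrow>
       4 * (0 * 1 + ((2 - 1 * 1) * 1 + 1) / sqrt (4 + t\<^sup>2) + 1 / sqrt 2)
       / (0 * (1 * (t\<^sup>2 / 2) + 1) + sqrt (4 + t\<^sup>2) + sqrt 2)\<^sup>2) (at_right 0)"
    by (rule Lim_transform_eventually)
  thus ?thesis by (simp add: green_limit_def)
qed

text \<open>Decay in t comes from \<open>disc_up\<close> alone, through
  \<open>one_minus_cos_ge\<close>. The bracket in \<open>green_deriv\<close> is at most 1/s + 2/s +
  1/s; with the prefactor 4 this yields 16 / (4 + t^2/18), and 288 = 16 * 18. The bound on s ensures
  z >= 1/2.\<close>

lemma abs_green_scaled_le:
  assumes s: "0 < s" "s\<^sup>2 \<le> 1/2" and t: "0 \<le> t" "s * t \<le> pi"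
  shows "\<bar>green_scaled s t\<bar> \<le> 288 * inverse (1 + t\<^sup>2)"
proof -
  define c where "c = cos (s * t)"
  define z where "z = 1 - s\<^sup>2"
  have s1: "s \<le> 1" by (rule power2_le_imp_le) (use s in auto)
  have z: "1/2 \<le> z" "z < 1" using s by (auto simp: z_def)
  have z0: "0 < z" using z by simp
  have c: "\<bar>c\<bar> \<le> 1" by (simp add: c_def)
  define A where "A = sqrt (disc_up z c)"
  define B where "B = sqrt (1 - z\<^sup>2)"
  have zc: "z * c \<le> z" "- z \<le> z * c" using mult_le_of_abs_le_1[OF c, of z] z by auto
  have A2: "s\<^sup>2 * (4 + t\<^sup>2 / 18) \<le> A\<^sup>2"
  proof -
    have "(s * t)\<^sup>2 / 18 \<le> 1 - c" unfolding c_def using s t by (intro one_minus_cos_ge) auto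
    hence "1/2 * ((s * t)\<^sup>2 / 18) \<le> z * (1 - c)" using z c by (intro mult_mono) auto
    hence "2 * s\<^sup>2 + 1/2 * ((s * t)\<^sup>2 / 18) \<le> 2 * (1 - z) + z * (1 - c)" by (simp add: z_def)
    hence "(2 * s\<^sup>2 + 1/2 * ((s * t)\<^sup>2 / 18)) * 2 \<le> (2 * (1 - z) + z * (1 - c)) * (2 - z * c + z)"
      using zc z c by (intro mult_mono) (linarith | simp)+
    also have "\<dots> = A\<^sup>2" using disc_up_pos[OF c z0 z(2)] by (simp only: A_def real_sqrt_pow2 less_imp_le disc_up_eq[symmetric])
    finally show ?thesis by (simp add: power_mult_distrib algebra_simps)
  qed
  have A: "2 * s \<le> A"
  proof (rule power2_le_imp_le)
    have "(2 * s)\<^sup>2 \<le> s\<^sup>2 * (4 + t\<^sup>2 / 18)" by (simp add: algebra_simps)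
    with A2 show "(2 * s)\<^sup>2 \<le> A\<^sup>2" by linarith
    show "0 \<le> A" using disc_up_pos[OF c _ z(2)] z by (simp add: A_def)
  qed
  have B: "s \<le> B"
  proof -
    have "s\<^sup>2 * 1 \<le> s\<^sup>2 * (2 - s\<^sup>2)" using s by (intro mult_left_mono) auto
    also have "\<dots> = 1 - z\<^sup>2" by (simp add: z_def power2_eq_square algebra_simps)
    finally show ?thesis using s by (auto simp: B_def intro: real_le_rsqrt)
  qed
  have D: "A \<le> green_denom z c"
    unfolding green_denom_def A_def[symmetric] B_def[symmetric] using zc z B s by linarith
  have "s\<^sup>2 * (4 + t\<^sup>2 / 18) \<le> (green_denom z c)\<^sup>2"
    using A2 power_mono[OF D, of 2] A s by linarith
  moreover have "\<bar>c + ((2 - z * c) * c + z) / A + z / B\<bar> \<le> 4 / s"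
  proof -
    have "\<bar>2 - z * c\<bar> \<le> 3" using zc z by linarith
    from mult_mono[OF this c] have "\<bar>(2 - z * c) * c\<bar> \<le> 3 * 1" by (simp add: abs_mult)
    hence "\<bar>((2 - z * c) * c + z) / A\<bar> \<le> 4 / (2 * s)"
      unfolding abs_divide using A s z by (intro frac_le) auto
    moreover have "\<bar>z / B\<bar> \<le> 1 / s"
      unfolding abs_divide using B s z by (intro frac_le) auto
    moreover have "\<bar>c\<bar> \<le> 1 / s" using c s s1 by (intro order.trans[OF c]) simp
    moreover have "\<bar>x + y + w\<bar> \<le> 4 / s"
      if "\<bar>y\<bar> \<le> 4 / (2 * s)" "\<bar>w\<bar> \<le> 1 / s" "\<bar>x\<bar> \<le> 1 / s" for x y w
    proof -
      have "\<bar>x + y + w\<bar> \<le> 1 / s + 4 / (2 * s) + 1 / s" using that by linarith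
      also have "\<dots> = 4 / s" by (simp add: field_simps)
      finally show ?thesis .
    qed
    ultimately show ?thesis by blast
  qed
  ultimately have "\<bar>green_deriv z c\<bar> \<le> 4 * (4 / s) / (s\<^sup>2 * (4 + t\<^sup>2 / 18))"
    unfolding green_deriv_def A_def[symmetric] B_def[symmetric] abs_divide abs_mult
    using s by (intro frac_le mult_mono) (auto intro!: mult_pos_pos add_pos_nonneg)
  from mult_left_mono[OF this, of "s ^ 3"]
  have "\<bar>green_scaled s t\<bar> \<le> s ^ 3 * (4 * (4 / s) / (s\<^sup>2 * (4 + t\<^sup>2 / 18)))"
    using s by (simp only: green_scaled_def abs_mult z_def c_def) simp
  also have "\<dots> = 16 / (4 + t\<^sup>2 / 18)"
    using s by (simp add: power3_eq_cube power2_eq_square)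
  also have "\<dots> = 288 / (72 + t\<^sup>2)"
    using add_pos_nonneg[of 72 "t\<^sup>2"] by (simp add: divide_simps)
  also have "\<dots> \<le> 288 / (1 + t\<^sup>2)"
    by (intro divide_left_mono mult_pos_pos add_pos_nonneg) auto
  also have "\<dots> = 288 * inverse (1 + t\<^sup>2)" by (rule divide_inverse)
  finally show ?thesis .
qed

lemma integral_green_limit:
  "(LINT t|lborel. indicator {0..} t * green_limit t) = 2"
proof -
  let ?R = "\<lambda>t::real. sqrt (4 + t\<^sup>2)"
  \<comment> \<open>Near the singularity the Green function is 4 / (sqrt (4 s^2 + \<theta>^2) + s
    sqrt 2), homogeneous of degree -1 in (s, \<theta>). Euler's identity turns its derivative in z =
    1 - s^2 into a \<theta>-derivative; \<open>?F\<close> is half of t times its value at s = 1,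
    \<theta> = t.\<close>
  let ?F = "\<lambda>t. 2 * t / (?R t + sqrt 2)"
  have pos: "4 + t\<^sup>2 > 0" for t :: real by (simp add: add_pos_nonneg)
  have nonneg: "0 \<le> green_limit t" for t
    using pos[of t] by (auto simp: green_limit_def intro!: divide_nonneg_nonneg mult_nonneg_nonneg add_nonneg_nonneg)
  have "(\<integral>\<^sup>+t. ennreal (green_limit t) * indicator {0..} t \<partial>lborel) = ennreal (2 - ?F 0)"
  proof (rule nn_integral_FTC_atLeast)
    show "green_limit \<in> borel_measurable borel" unfolding green_limit_def by measurable
    fix t :: real
    show "0 \<le> green_limit t" by (rule nonneg)
    have R: "?R t > 0" "(?R t)\<^sup>2 = 4 + t\<^sup>2" using pos[of t] by auto
    have dR: "(?R has_real_derivative t / ?R t) (at t)"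
      by (rule derivative_eq_intros refl | use pos[of t] in \<open>simp add: field_simps\<close>)+
    have num: "((\<lambda>t. 2 * t) has_real_derivative 2) (at t)"
      by (auto intro!: derivative_eq_intros)
    have den: "((\<lambda>t. ?R t + sqrt 2) has_real_derivative t / ?R t) (at t)"
      using DERIV_add[OF dR DERIV_const] by simp
    have "?R t + sqrt 2 \<noteq> 0" using add_pos_pos[OF R(1), of "sqrt 2"] by simp
    from DERIV_divide[OF num den this]
    have "(?F has_real_derivative (2 * (?R t + sqrt 2) - 2 * t * (t / ?R t)) / ((?R t + sqrt 2) * (?R t + sqrt 2))) (at t)" .
    moreover have "2 * (?R t + sqrt 2) - 2 * t * (t / ?R t) = 4 * (2 / ?R t + 1 / sqrt 2)"
    proof -
      have "?R t - t * (t / ?R t) = 4 / ?R t" using R by (simp add: field_simps power2_eq_square)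
      moreover have "sqrt 2 = 2 * (1 / sqrt 2)" by (simp add: field_simps)
      moreover have "2 * (2 / ?R t) = 4 / ?R t" by simp
      ultimately show ?thesis by argo
    qed
    ultimately show "(?F has_real_derivative green_limit t) (at t)"
      by (simp add: green_limit_def power2_eq_square)
  next
    show "(?F \<longlongrightarrow> 2) at_top" by real_asymp
  qed
  hence "(\<integral>\<^sup>+t. ennreal (indicator {0..} t * green_limit t) \<partial>lborel) = 2"
    by (simp add: mult.commute[of "indicator {0..} _"] ennreal_mult'' ennreal_indicator flip: ennreal_numeral)
  moreover have "(\<lambda>t. indicator {0..} t * green_limit t) \<in> borel_measurable lborel"
    unfolding green_limit_def by measurable
  ultimately show ?thesis
    using nonneg by (subst integral_eq_nn_integral) auto
qed

lemma integral_green_deriv_scaled: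
  assumes z: "0 < z" "z < 1"
  shows "(1 - z) * integral {0..pi} (\<lambda>\<theta>. green_deriv z (cos \<theta>)) =
    (LINT t|lborel. indicator {0..pi} (sqrt (1 - z) * t) * green_scaled (sqrt (1 - z)) t)"
proof -
  define s where "s = sqrt (1 - z)"
  have s: "s > 0" "s\<^sup>2 = 1 - z" using z by (simp_all add: s_def)
  have "continuous_on {0..pi} (\<lambda>\<theta>. green_deriv z (cos \<theta>))"
  proof -
    have "z\<^sup>2 < 1" using z by (simp add: power_less_one_iff abs_square_less_1)
    moreover have "disc_up z (cos \<theta>) \<noteq> 0" "green_denom z (cos \<theta>) \<noteq> 0" for \<theta>
      using disc_up_pos[OF abs_cos_le_one z, of \<theta>] green_denom_pos[OF abs_cos_le_one z, of \<theta>] by auto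
    moreover have "continuous_on A (\<lambda>\<theta>. disc_up z (cos \<theta>))" for A
      unfolding disc_up_def by (intro continuous_intros)
    moreover from this have "continuous_on A (\<lambda>\<theta>. green_denom z (cos \<theta>))" for A
      unfolding green_denom_def by (intro continuous_intros) auto
    ultimately show ?thesis
      unfolding green_deriv_def by (intro continuous_intros) auto
  qed
  hence "set_integrable lborel {0..pi} (\<lambda>\<theta>. green_deriv z (cos \<theta>))"
    by (rule borel_integrable_atLeastAtMost')
  hence "integral {0..pi} (\<lambda>\<theta>. green_deriv z (cos \<theta>)) =
      (LINT \<theta>|lborel. indicator {0..pi} \<theta> * green_deriv z (cos \<theta>))"
    by (simp add: set_borel_integral_eq_integral(2)[symmetric] set_lebesgue_integral_def)
  also have "\<dots> = s * (LINT t|lborel. indicator {0..pi} (s * t) * green_deriv z (cos (s * t)))"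
    using lborel_integral_real_affine[of s "\<lambda>\<theta>. indicator {0..pi} \<theta> * green_deriv z (cos \<theta>)" 0] s by simp
  \<comment> \<open>The power s^3 combines 1 - z = s^2 with d\<theta> = s dt.\<close>
  finally have "(1 - z) * integral {0..pi} (\<lambda>\<theta>. green_deriv z (cos \<theta>)) =
      s ^ 3 * (LINT t|lborel. indicator {0..pi} (s * t) * green_deriv z (cos (s * t)))"
    using s by (simp add: power3_eq_cube power2_eq_square)
  also have "\<dots> = (LINT t|lborel. indicator {0..pi} (s * t) * green_scaled s t)"
    using s by (subst integral_mult_right_zero[symmetric]) (simp add: green_scaled_def mult_ac)
  finally show ?thesis by (simp add: s_def)
qed

lemma tendsto_integral_green_deriv:
  "((\<lambda>z. (1 - z) * integral {0..pi} (\<lambda>\<theta>. green_deriv z (cos \<theta>))) \<longlongrightarrow> 2) (at_left 1)"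
\<comment> \<open>Dominated convergence works along sequences; staying above 1/2 supplies the bound
  on s in \<open>abs_green_scaled_le\<close>.\<close>
proof (rule tendsto_at_left_sequentially[of "1/2"])
  fix Z :: "nat \<Rightarrow> real"
  assume Z: "\<And>n. Z n < 1" "\<And>n. 1/2 < Z n" and lim: "Z \<longlonglongrightarrow> 1"
  define S where "S n = sqrt (1 - Z n)" for n
  have S: "S n > 0" "(S n)\<^sup>2 \<le> 1/2" for n
    using Z[of n] by (auto simp: S_def)
  have "S \<longlonglongrightarrow> sqrt (1 - 1)" unfolding S_def by (intro tendsto_intros lim)
  hence S0: "filterlim S (at_right 0) sequentially"
    using S(1) by (auto simp: filterlim_at less_imp_neq[symmetric] intro!: always_eventually)
  have "(\<lambda>n. LINT t|lborel. indicator {0..pi} (S n * t) * green_scaled (S n) t)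
      \<longlonglongrightarrow> (LINT t|lborel. indicator {0..} t * green_limit t)"
  proof (rule integral_dominated_convergence)
    show "(\<lambda>t. indicator {0..} t * green_limit t) \<in> borel_measurable lborel"
      unfolding green_limit_def by measurable
    show "(\<lambda>t. indicator {0..pi} (S n * t) * green_scaled (S n) t) \<in> borel_measurable lborel" for n
      unfolding green_scaled_def green_deriv_def green_denom_def disc_up_def by measurable
    show "integrable lborel (\<lambda>t::real. 288 * inverse (1 + t\<^sup>2))"
      using integrable_inverse_1_plus_square
      by (simp add: set_integrable_def einterval_eq_UNIV)
    show "AE t in lborel. (\<lambda>n. indicator {0..pi} (S n * t) * green_scaled (S n) t)
        \<longlonglongrightarrow> indicator {0..} t * green_limit t"
    proof (intro AE_I2)
      fix t :: real
      show "(\<lambda>n. indicator {0..pi} (S n * t) * green_scaled (S n) t) \<longlonglongrightarrow> indicator {0..} t * green_limit t"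
      proof (cases "t \<ge> 0")
        case True
        have "(\<lambda>n. S n * t) \<longlonglongrightarrow> 0 * t"
          using S0 by (intro tendsto_intros) (auto simp: filterlim_at)
        hence "eventually (\<lambda>n. S n * t < pi) sequentially"
          by (rule order_tendstoD) simp
        hence "eventually (\<lambda>n. green_scaled (S n) t = indicator {0..pi} (S n * t) * green_scaled (S n) t) sequentially"
          by eventually_elim (use S True in \<open>auto simp: indicator_def less_imp_le\<close>)
        with filterlim_compose[OF tendsto_green_scaled S0]
        have "(\<lambda>n. indicator {0..pi} (S n * t) * green_scaled (S n) t) \<longlonglongrightarrow> green_limit t"
          by (rule Lim_transform_eventually)
        thus ?thesis using True by simp
      next
        case False
        hence "S n * t < 0" for n using S by (simp add: mult_pos_neg)
        hence "indicator {0..pi} (S n * t) = (0 :: real)" for n by (simp add: indicator_def not_le)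
        thus ?thesis using False by simp
      qed
    qed
    show "AE t in lborel. norm (indicator {0..pi} (S n * t) * green_scaled (S n) t) \<le> 288 * inverse (1 + t\<^sup>2)" for n
    proof (intro AE_I2)
      fix t :: real
      show "norm (indicator {0..pi} (S n * t) * green_scaled (S n) t) \<le> 288 * inverse (1 + t\<^sup>2)"
      proof (cases "S n * t \<in> {0..pi}")
        case True
        hence "t \<ge> 0" using S(1)[of n] by (simp add: zero_le_mult_iff)
        thus ?thesis using abs_green_scaled_le[OF S \<open>t \<ge> 0\<close>, of n] True by simp
      next
        case False
        thus ?thesis by (simp add: add_nonneg_nonneg)
      qed
    qed
  qed
  moreover have "0 < Z n" for n using Z(2)[of n] by linarith
  hence "(1 - Z n) * integral {0..pi} (\<lambda>\<theta>. green_deriv (Z n) (cos \<theta>)) =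
      (LINT t|lborel. indicator {0..pi} (S n * t) * green_scaled (S n) t)" for n
    using Z(1) unfolding S_def by (rule integral_green_deriv_scaled)
  ultimately show "(\<lambda>n. (1 - Z n) * integral {0..pi} (\<lambda>\<theta>. green_deriv (Z n) (cos \<theta>))) \<longlonglongrightarrow> 2"
    by (simp add: integral_green_limit)
qed simp

text \<open>The full series at z = sqrt w loses its odd terms by parity; halving turns the factor 2n
  into n.\<close>

lemma HPHC_even_return_sums:
  assumes walk: "HPHC_walk M C" and w: "0 < w" "w < 1"
  shows "(\<lambda>n. real n * \<P>(\<omega> in M. C (2 * n) \<omega> = (0, 0)) * w ^ n) sums
    (sqrt w / (2 * pi) * integral {0..pi} (\<lambda>\<theta>. green_deriv (sqrt w) (cos \<theta>)))"
proof -
  let ?p = "\<lambda>n. \<P>(\<omega> in M. C n \<omega> = (0, 0))"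
  let ?J = "integral {0..pi} (\<lambda>\<theta>. green_deriv (sqrt w) (cos \<theta>))"
  have "(\<lambda>n. real n * ?p n * sqrt w ^ n) sums (sqrt w / pi * ?J)"
    using w by (intro HPHC_return_deriv_sums[OF walk]) auto
  moreover have "real n * ?p n * sqrt w ^ n = 0" if "n \<notin> range (\<lambda>n. 2 * n)" for n
  proof -
    have "odd n" using that by (auto elim!: evenE)
    thus ?thesis using HPHC_parity[OF walk, of n 0 0] by simp
  qed
  moreover have "strict_mono (\<lambda>n::nat. 2 * n)" by (simp add: strict_mono_def)
  ultimately have "(\<lambda>n. real (2 * n) * ?p (2 * n) * sqrt w ^ (2 * n)) sums (sqrt w / pi * ?J)"
    using sums_mono_reindex[of "\<lambda>n::nat. 2 * n" "\<lambda>n. real n * ?p n * sqrt w ^ n"] by simp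
  moreover have "sqrt w ^ (2 * n) = w ^ n" for n using w by (simp add: power_mult)
  ultimately have "(\<lambda>n. real (2 * n) * ?p (2 * n) * w ^ n) sums (sqrt w / pi * ?J)" by (simp only:)
  from sums_divide[OF this, of 2] show ?thesis by (simp add: mult_ac)
qed

theorem theorem3p1:
  fixes M :: "'w measure" and C :: "nat \<Rightarrow> 'w \<Rightarrow> int \<times> int"
  assumes "HPHC_walk M C"
  shows "(\<lambda>N. \<P>(\<omega> in M. C (2 * N) \<omega> = (0, 0))) \<sim>[at_top] (\<lambda>N. 2 / (pi * real N))"
proof -
  let ?a = "\<lambda>N. \<P>(\<omega> in M. C (2 * N) \<omega> = (0, 0))"
  let ?J = "\<lambda>z. integral {0..pi} (\<lambda>\<theta>. green_deriv z (cos \<theta>))"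
  note sums = HPHC_even_return_sums[OF assms]
  have "(\<lambda>N. real N * ?a N) \<longlonglongrightarrow> 2 / pi"
  proof (rule karamata_decseq[OF decseq_HPHC_return[OF assms]])
    show "0 \<le> ?a n" for n by simp
    show "summable (\<lambda>n. real n * ?a n * w ^ n)" if "w \<in> {0<..<1}" for w
      using sums[of w] that by (auto simp: sums_iff)
    have near: "eventually (\<lambda>w::real. w \<in> {0<..<1}) (at_left 1)"
      by (rule eventually_at_leftI[of 0]) auto
    have s: "((\<lambda>w::real. sqrt w) \<longlongrightarrow> 1) (at_left 1)"
      by (auto intro!: tendsto_eq_intros)
    have "filterlim (\<lambda>w::real. sqrt w) (at_left 1) (at_left 1)"
      unfolding filterlim_at using s near by (auto elim!: eventually_mono)
    from filterlim_compose[OF tendsto_integral_green_deriv this]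
    \<comment> \<open>Here 1 - w is split as (1 + sqrt w) (1 - sqrt w), the second factor being the
      one that the limit of the integral is scaled by.\<close>
    have "((\<lambda>w. (1 + sqrt w) * sqrt w / (2 * pi) * ((1 - sqrt w) * ?J (sqrt w))) \<longlongrightarrow> (1 + 1) * 1 / (2 * pi) * 2) (at_left 1)"
      by (intro tendsto_intros s) auto
    moreover have "eventually (\<lambda>w. (1 + sqrt w) * sqrt w / (2 * pi) * ((1 - sqrt w) * ?J (sqrt w)) =
        (1 - w) * (\<Sum>n. real n * ?a n * w ^ n)) (at_left 1)"
      using near
    proof eventually_elim
      case (elim w)
      have "(1 + sqrt w) * (1 - sqrt w) = 1 - w" using elim by (simp add: algebra_simps)
      moreover have "(\<Sum>n. real n * ?a n * w ^ n) = sqrt w / (2 * pi) * ?J (sqrt w)"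
        using sums[of w] elim by (simp add: sums_iff)
      ultimately show ?case by (metis (no_types, lifting) mult.assoc mult.commute times_divide_eq_left)
    qed
    ultimately have "((\<lambda>w. (1 - w) * (\<Sum>n. real n * ?a n * w ^ n)) \<longlongrightarrow> (1 + 1) * 1 / (2 * pi) * 2) (at_left 1)"
      by (rule Lim_transform_eventually)
    thus "((\<lambda>w. (1 - w) * (\<Sum>n. real n * ?a n * w ^ n)) \<longlongrightarrow> 2 / pi) (at_left 1)"
      by simp
  qed
  hence "(\<lambda>N. real N * ?a N * (pi / 2)) \<longlonglongrightarrow> 2 / pi * (pi / 2)"
    by (intro tendsto_intros)
  \<comment> \<open>The rewriting holds even at N = 0, where division by zero makes both expressions
    0.\<close>
  hence "(\<lambda>N. ?a N / (2 / (pi * real N))) \<longlonglongrightarrow> 1" by (simp add: mult_ac)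
  thus ?thesis by (rule asymp_equivI')
qed

end
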